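(* Let $n\geq 1$ and $\sigma\in S_n$. The graph $\mathcal{B}(\sigma)$ is planar if and only if $\sigma$ avoids $321$ and avoids all permutations $\pi\in S_m$ with $m\leq 8$ and $\ell(\pi)\geq 4$.
   Context: Permutations are written in one-line notation. The length $\ell(\pi)$ of $\pi\in S_n$ is the minimum number of adjacent transpositions $(i\ i+1)$ whose product is $\pi$; equivalently, it is the number of inversions, i.e. pairs $i<j$ with $\pi(i)>\pi(j)$. For $\sigma,\tau\in S_n$ write $\sigma\prec\tau$ if $\ell(\sigma)<\ell(\tau)$ and there is a transposition $t=(i\ j)$ (not necessarily adjacent) with $\sigma=\tau t$. Bruhat order $\leq$ on $S_n$ is the reflexive transitive closure of $\prec$. The Bruhat graph of $S_n$ is the directed graph with vertex set $S_n$ and an edge $\sigma\to\tau$ whenever $\sigma\prec\tau$ (the difference $\ell(\tau)-\ell(\sigma)$ need not be $1$). For $\pi\in S_n$, the Bruhat graph $\mathcal{B}(\pi)$ is the induced subgraph on the vertices $\sigma\in S_n$ with $\sigma\leq\pi$ in Bruhat order. For $\pi\in S_k$ and $\tau\in S_n$ with $k\leq n$, $\tau$ contains $\pi$ if there are indices $1\leq i_1<\cdots<i_k\leq n$ such that for all $a,b$, $\tau(i_a)<\tau(i_b)$ if and only if $\pi(a)<\pi(b)$; otherwise (or if $k>n$) $\tau$ avoids $\pi$. A graph is planar if it can be drawn in the plane without edges crossing; for $\mathcal{B}(\sigma)$ this refers to the underlying undirected graph. *)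

theory Defs
  imports
    "HOL-Analysis.Analysis"
    "Graph_Theory.Digraph_Component"
    "HOL-Combinatorics.Permutations"
begin

text \<open>
  An element of \<open>S\<^sub>n\<close> is a function \<open>\<pi> :: nat \<Rightarrow> nat\<close> with \<open>\<pi> permutes {1..n}\<close>; it is the
  identity outside \<open>{1..n}\<close>. The product of permutations is composition.
\<close>

definition one_line :: "nat list \<Rightarrow> nat \<Rightarrow> nat" where
  "one_line xs i = (if i \<in> {1..length xs} then xs ! (i - 1) else i)"

definition adj_word_prod :: "nat list \<Rightarrow> nat \<Rightarrow> nat" where
  "adj_word_prod is = foldr (\<lambda>i f. Transposition.transpose i (Suc i) \<circ> f) is id"

definition perm_length :: "nat \<Rightarrow> (nat \<Rightarrow> nat) \<Rightarrow> nat" where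
  "perm_length n \<pi> =
     (LEAST k. \<exists>is. length is = k \<and> set is \<subseteq> {1..<n} \<and> \<pi> = adj_word_prod is)"


subsection \<open>Bruhat order and Bruhat graphs\<close>

definition bruhat_step :: "nat \<Rightarrow> (nat \<Rightarrow> nat) \<Rightarrow> (nat \<Rightarrow> nat) \<Rightarrow> bool" where
  "bruhat_step n \<sigma> \<tau> \<longleftrightarrow>
     \<sigma> permutes {1..n} \<and> \<tau> permutes {1..n} \<and> perm_length n \<sigma> < perm_length n \<tau> \<and>
     (\<exists>i j. 1 \<le> i \<and> i < j \<and> j \<le> n \<and> \<sigma> = \<tau> \<circ> Transposition.transpose i j)"

definition bruhat_le :: "nat \<Rightarrow> (nat \<Rightarrow> nat) \<Rightarrow> (nat \<Rightarrow> nat) \<Rightarrow> bool" where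
  "bruhat_le n = (bruhat_step n)\<^sup>*\<^sup>*"

definition bruhat_graph :: "nat \<Rightarrow> (nat \<Rightarrow> nat) pair_pre_digraph" where
  "bruhat_graph n =
     \<lparr> pverts = {\<sigma>. \<sigma> permutes {1..n}}, parcs = {(\<sigma>, \<tau>). bruhat_step n \<sigma> \<tau>} \<rparr>"

definition lower_bruhat_graph ::
    "nat \<Rightarrow> (nat \<Rightarrow> nat) \<Rightarrow> (nat \<Rightarrow> nat, (nat \<Rightarrow> nat) \<times> (nat \<Rightarrow> nat)) pre_digraph" where
  "lower_bruhat_graph n \<pi> =
     with_proj (bruhat_graph n) \<restriction> {\<sigma> \<in> pverts (bruhat_graph n). bruhat_le n \<sigma> \<pi>}"


subsection \<open>Pattern containment\<close>

definition perm_contains :: "nat \<Rightarrow> (nat \<Rightarrow> nat) \<Rightarrow> nat \<Rightarrow> (nat \<Rightarrow> nat) \<Rightarrow> bool" where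
  "perm_contains n \<tau> k \<pi> \<longleftrightarrow>
     (\<exists>f. strict_mono_on {1..k} f \<and> f ` {1..k} \<subseteq> {1..n} \<and>
          (\<forall>a\<in>{1..k}. \<forall>b\<in>{1..k}. \<tau> (f a) < \<tau> (f b) \<longleftrightarrow> \<pi> a < \<pi> b))"

abbreviation perm_avoids :: "nat \<Rightarrow> (nat \<Rightarrow> nat) \<Rightarrow> nat \<Rightarrow> (nat \<Rightarrow> nat) \<Rightarrow> bool" where
  "perm_avoids n \<tau> k \<pi> \<equiv> \<not> perm_contains n \<tau> k \<pi>"


subsection \<open>Planarity\<close>

definition undirected_edges :: "('a, 'b) pre_digraph \<Rightarrow> 'a set set" where
  "undirected_edges G = (\<lambda>e. {tail G e, head G e}) ` arcs G"

text \<open>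
  A drawing sends vertices to distinct points of the plane \<open>\<complex>\<close> and every undirected edge to a
  simple curve between the images of its ends (an arc, or a closed curve for a loop) which meets
  no other vertex; two different edges meet at most in the images of common ends.
\<close>

definition plane_drawing ::
    "('a, 'b) pre_digraph \<Rightarrow> ('a \<Rightarrow> complex) \<Rightarrow> ('a set \<Rightarrow> real \<Rightarrow> complex) \<Rightarrow> bool" where
  "plane_drawing G pos curve \<longleftrightarrow>
     inj_on pos (verts G) \<and>
     (\<forall>e \<in> undirected_edges G.
        simple_path (curve e) \<and>
        {pathstart (curve e), pathfinish (curve e)} = pos ` e \<and>
        path_image (curve e) \<inter> pos ` verts G = pos ` e) \<and>
     (\<forall>e \<in> undirected_edges G. \<forall>f \<in> undirected_edges G. e \<noteq> f \<longrightarrow>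
        path_image (curve e) \<inter> path_image (curve f) \<subseteq> pos ` (e \<inter> f))"

definition planar :: "('a, 'b) pre_digraph \<Rightarrow> bool" where
  "planar G \<longleftrightarrow> (\<exists>pos curve. plane_drawing G pos curve)"


subsection \<open>Length as the number of inversions\<close>

definition inversions :: "nat \<Rightarrow> (nat \<Rightarrow> nat) \<Rightarrow> (nat \<times> nat) set" where
  "inversions n \<pi> = {(i, j). 1 \<le> i \<and> i < j \<and> j \<le> n \<and> \<pi> i > \<pi> j}"

lemma adj_word_prod_snoc:
  "adj_word_prod (is @ [i]) = adj_word_prod is \<circ> Transposition.transpose i (Suc i)"
proof -
  have *: "foldr (\<lambda>i f. Transposition.transpose i (Suc i) \<circ> f) is g
      = foldr (\<lambda>i f. Transposition.transpose i (Suc i) \<circ> f) is id \<circ> g" for g :: "nat \<Rightarrow> nat"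
    by (induction "is") (auto simp: o_assoc)
  show ?thesis
    unfolding adj_word_prod_def using *[of "Transposition.transpose i (Suc i)"] by simp
qed

lemma finite_inversions: "finite (inversions n \<pi>)"
  by (rule finite_subset[of _ "{1..n} \<times> {1..n}"]) (auto simp: inversions_def)

lemma card_inversions_ascent:
  assumes i: "1 \<le> i" "i < n" and asc: "\<pi> i < \<pi> (Suc i)"
  shows "card (inversions n (\<pi> \<circ> Transposition.transpose i (Suc i))) = Suc (card (inversions n \<pi>))"
proof -
  let ?t = "Transposition.transpose i (Suc i)"
  let ?T = "map_prod ?t ?t"
  have eq: "inversions n (\<pi> \<circ> ?t) = insert (i, Suc i) (?T ` inversions n \<pi>)"
  proof (intro equalityI subsetI)
    fix p assume "p \<in> inversions n (\<pi> \<circ> ?t)"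
    then obtain a b where p: "p = (a, b)" "1 \<le> a" "a < b" "b \<le> n" "\<pi> (?t a) > \<pi> (?t b)"
      by (auto simp: inversions_def)
    show "p \<in> insert (i, Suc i) (?T ` inversions n \<pi>)"
    proof (cases "a = i \<and> b = Suc i")
      case False
      have "(?t a, ?t b) \<in> inversions n \<pi>"
        using p i False by (auto simp: inversions_def Transposition.transpose_def split: if_splits)
      moreover have "p = ?T (?t a, ?t b)" by (simp add: p)
      ultimately show ?thesis by blast
    qed (simp add: p)
  next
    fix p assume "p \<in> insert (i, Suc i) (?T ` inversions n \<pi>)"
    then show "p \<in> inversions n (\<pi> \<circ> ?t)"
    proof
      assume "p = (i, Suc i)"
      then show ?thesis using i asc by (auto simp: inversions_def)
    next
      assume "p \<in> ?T ` inversions n \<pi>"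
      then obtain a b where p: "p = (?t a, ?t b)" "1 \<le> a" "a < b" "b \<le> n" "\<pi> a > \<pi> b"
        by (auto simp: inversions_def)
      have "\<not> (a = i \<and> b = Suc i)" using p asc by auto
      then have "1 \<le> ?t a \<and> ?t a < ?t b \<and> ?t b \<le> n"
        using p(2-4) i by (auto simp: Transposition.transpose_def)
      then show ?thesis using p by (simp add: inversions_def)
    qed
  qed
  have "(i, Suc i) \<notin> ?T ` inversions n \<pi>"
  proof
    assume "(i, Suc i) \<in> ?T ` inversions n \<pi>"
    then obtain a b where ab: "i = ?t a" "Suc i = ?t b" "a < b" by (auto simp: inversions_def)
    from ab(1) have "a = Suc i" by (metis transpose_apply_first transpose_involutory)
    moreover from ab(2) have "b = i" by (metis transpose_apply_second transpose_involutory)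
    ultimately show False using ab(3) by simp
  qed
  moreover have "inj ?T" by (intro prod.inj_map) (simp_all add: inj_transpose)
  then have "card (?T ` inversions n \<pi>) = card (inversions n \<pi>)"
    by (intro card_image) (auto intro: inj_on_subset)
  ultimately show ?thesis by (simp add: eq finite_inversions)
qed

lemma adj_word_prod_permutes:
  "set is \<subseteq> {1..<n} \<Longrightarrow> adj_word_prod is permutes {1..n}"
proof (induction "is" rule: rev_induct)
  case Nil
  show ?case unfolding adj_word_prod_def foldr.simps by (simp add: permutes_def)
next
  case (snoc i "is")
  then show ?case unfolding adj_word_prod_snoc
    by (intro permutes_compose permutes_swap_id) auto
qed

lemma card_inversions_le_word:
  "set is \<subseteq> {1..<n} \<Longrightarrow> card (inversions n (adj_word_prod is)) \<le> length is"
proof (induction "is" rule: rev_induct)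
  case Nil
  have "inversions n (adj_word_prod []) = {}" by (auto simp: inversions_def adj_word_prod_def)
  then show ?case by simp
next
  case (snoc i "is")
  let ?p = "adj_word_prod is" and ?t = "Transposition.transpose i (Suc i)"
  have i: "1 \<le> i" "i < n" using snoc.prems by auto
  have "inj ?p" using adj_word_prod_permutes[of "is" n] snoc.prems by (auto intro: permutes_inj)
  then have ne: "?p i \<noteq> ?p (Suc i)" by (simp add: inj_eq)
  have IH: "card (inversions n ?p) \<le> length is" using snoc by simp
  show ?case
  proof (cases "?p i < ?p (Suc i)")
    case True
    then show ?thesis using card_inversions_ascent[OF i True] IH
      unfolding adj_word_prod_snoc length_append_singleton by linarith
  next
    case False
    then have "(?p \<circ> ?t) i < (?p \<circ> ?t) (Suc i)" using ne by simp
    from card_inversions_ascent[OF i this]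
    have "card (inversions n ?p) = Suc (card (inversions n (?p \<circ> ?t)))"
      by (simp only: comp_assoc transpose_comp_involutory comp_id)
    then show ?thesis using IH
      unfolding adj_word_prod_snoc length_append_singleton by linarith
  qed
qed

lemma permutes_no_descent_id:
  assumes "\<pi> permutes {1..n::nat}" and "\<And>i. 1 \<le> i \<Longrightarrow> i < n \<Longrightarrow> \<pi> i \<le> \<pi> (Suc i)"
  shows "\<pi> = id"
proof -
  have "inj \<pi>" using assms(1) by (rule permutes_inj)
  then have step: "\<pi> i < \<pi> (Suc i)" if "1 \<le> i" "i < n" for i
    using assms(2)[OF that] by (simp add: inj_eq le_less)
  have low: "i \<le> \<pi> i" if "1 \<le> i" "i \<le> n" for i
    using that
  proof (induction i rule: nat_induct_at_least)
    case base
    then show ?case using permutes_in_image[OF assms(1), of 1] by auto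
  next
    case (Suc i)
    then show ?case using step[of i] by auto
  qed
  have "\<pi> i \<ge> i" for i
    using low[of i] assms(1) by (cases "i \<in> {1..n}") (auto simp: permutes_def)
  then show ?thesis using permutes_natset_ge[OF assms(1)] by auto
qed

lemma ex_word_card_inversions:
  assumes "\<pi> permutes {1..n}"
  shows "\<exists>is. length is = card (inversions n \<pi>) \<and> set is \<subseteq> {1..<n} \<and> \<pi> = adj_word_prod is"
  using assms
proof (induction "card (inversions n \<pi>)" arbitrary: \<pi> rule: less_induct)
  case less
  show ?case
  proof (cases "\<exists>i. 1 \<le> i \<and> i < n \<and> \<pi> i > \<pi> (Suc i)")
    case True
    then obtain i where i: "1 \<le> i" "i < n" "\<pi> i > \<pi> (Suc i)" by blast
    let ?t = "Transposition.transpose i (Suc i)"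
    have perm: "\<pi> \<circ> ?t permutes {1..n}"
      using less.prems i by (intro permutes_compose permutes_swap_id) auto
    have "(\<pi> \<circ> ?t) i < (\<pi> \<circ> ?t) (Suc i)" using i by simp
    from card_inversions_ascent[OF i(1,2) this]
    have c: "card (inversions n \<pi>) = Suc (card (inversions n (\<pi> \<circ> ?t)))"
      by (simp only: comp_assoc transpose_comp_involutory comp_id)
    then obtain "is" where w: "length is = card (inversions n (\<pi> \<circ> ?t))" "set is \<subseteq> {1..<n}"
        "\<pi> \<circ> ?t = adj_word_prod is"
      using less.hyps[OF _ perm] by auto
    have "adj_word_prod (is @ [i]) = \<pi>"
      unfolding adj_word_prod_snoc w(3)[symmetric] by (simp only: comp_assoc transpose_comp_involutory comp_id)
    then show ?thesis using w c i by (intro exI[of _ "is @ [i]"]) auto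
  next
    case False
    then have "\<pi> = id" using permutes_no_descent_id[OF less.prems] by force
    moreover have "inversions n id = {}" by (auto simp: inversions_def)
    ultimately show ?thesis by (intro exI[of _ "[]"]) (simp add: adj_word_prod_def)
  qed
qed

lemma perm_length_eq_card_inversions:
  assumes "\<pi> permutes {1..n}"
  shows "perm_length n \<pi> = card (inversions n \<pi>)"
  unfolding perm_length_def
  by (rule Least_equality)
     (use ex_word_card_inversions[OF assms] card_inversions_le_word in auto)

end

theory Submission
  imports Defs "HOL-Complex_Analysis.Winding_Numbers" "HOL-Library.Sublist"
begin

hide_const (open) Digraph_Component.connected

text \<open>
  Going down along inversions, the lower interval of a permutation with entries \<open>c > b > a\<close> in
  positions \<open>i < j < k\<close> contains all six rearrangements of these entries; any even and any odd one
  differ by a transposition, so they span a \<open>K\<^sub>3\<^sub>,\<^sub>3\<close>. Otherwise take a reduced word of \<open>\<sigma>\<close>. If a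
  letter \<open>d\<close> occurs twice, then \<open>[d, e, d]\<close> is a subword with \<open>\<bar>d - e\<bar> = 1\<close>, and the subword
  property gives a permutation below \<open>\<sigma>\<close> containing 321. If all letters are distinct, the strong
  exchange property identifies the lower Bruhat graph with the cube of dimension \<open>\<ell>(\<sigma>)\<close>, which is
  planar exactly up to dimension 3. Finally, four inversions occupy at most eight positions.

  Non-planarity of \<open>K\<^sub>3\<^sub>,\<^sub>3\<close> is derived from the Jordan curve theorem. The paths between two vertices of
  the same class form a theta curve. No face of a theta curve is incident with the interiors of
  all three arcs, so the third vertex of the class cannot be joined to its neighbours.
\<close>

subsection \<open>Theta curves\<close>

definition theta_curve ::
    "complex \<Rightarrow> complex \<Rightarrow> (real \<Rightarrow> complex) \<Rightarrow> (real \<Rightarrow> complex) \<Rightarrow> (real \<Rightarrow> complex) \<Rightarrow> bool" where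
  "theta_curve a b P Q R \<longleftrightarrow> a \<noteq> b \<and>
     arc P \<and> pathstart P = a \<and> pathfinish P = b \<and>
     arc Q \<and> pathstart Q = a \<and> pathfinish Q = b \<and>
     arc R \<and> pathstart R = a \<and> pathfinish R = b \<and>
     path_image P \<inter> path_image Q = {a, b} \<and>
     path_image Q \<inter> path_image R = {a, b} \<and>
     path_image P \<inter> path_image R = {a, b}"

lemma theta_curve_rotate: "theta_curve a b P Q R \<Longrightarrow> theta_curve a b Q R P"
  by (auto simp: theta_curve_def)

lemma theta_curve_swap: "theta_curve a b P Q R \<Longrightarrow> theta_curve a b Q P R"
  by (auto simp: theta_curve_def)

lemma theta_curve_loop:
  assumes "theta_curve a b P Q R"
  shows "simple_path (P +++ reversepath Q)"
    and "pathfinish (P +++ reversepath Q) = pathstart (P +++ reversepath Q)"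
    and "path_image (P +++ reversepath Q) = path_image P \<union> path_image Q"
  using assms by (auto simp: theta_curve_def simple_path_join_loop_eq path_image_join arc_reversepath)

text \<open>Meant for whichever arc turns out to run inside the cycle of the other two; one point
  \<open>r\<close> of it in there suffices.\<close>

lemma theta_curve_split:
  assumes th: "theta_curve a b P Q R"
    and r: "r \<in> path_image R" "r \<in> inside (path_image P \<union> path_image Q)"
  shows "inside (path_image P \<union> path_image R) \<union> inside (path_image Q \<union> path_image R) \<union>
     (path_image R - {a, b}) = inside (path_image P \<union> path_image Q)"
proof -
  have ne: "path_image R \<inter> inside (path_image P \<union> path_image Q) \<noteq> {}" using r by blast
  have th': "simple_path P" "simple_path Q" "simple_path R" "pathstart P = a" "pathfinish P = b"
      "pathstart Q = a" "pathfinish Q = b" "pathstart R = a" "pathfinish R = b" "a \<noteq> b"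
      "path_image P \<inter> path_image Q = {a, b}" "path_image P \<inter> path_image R = {a, b}"
      "path_image Q \<inter> path_image R = {a, b}"
    using th by (simp_all add: theta_curve_def arc_imp_simple_path)
  show ?thesis
    by (rule split_inside_simple_closed_curve[OF th'(1,4,5,2,6,7,3,8-13) ne])
qed

text \<open>\<open>P\<close> followed by \<open>Q\<close> reversed winds around \<open>z\<close> by
  the difference of the two values, which is 1 or -1 inside a simple closed curve and 0 outside.
  Comparing the three cycles of a theta curve thus becomes a matter of equality among three complex
  numbers.\<close>

lemma theta_curve_winding:
  assumes th: "theta_curve a b P Q R"
    and z: "z \<notin> path_image P \<union> path_image Q"
  shows "z \<in> inside (path_image P \<union> path_image Q) \<longleftrightarrow> winding_number P z \<noteq> winding_number Q z"
proof -
  let ?c = "P +++ reversepath Q"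
  note c = theta_curve_loop[OF th]
  have w: "winding_number ?c z = winding_number P z - winding_number Q z"
    using th z by (subst winding_number_join)
      (auto simp: theta_curve_def arc_imp_path winding_number_reversepath)
  show ?thesis
  proof
    assume "z \<in> inside (path_image P \<union> path_image Q)"
    then have "winding_number ?c z \<in> {-1, 1}"
      using simple_closed_path_winding_number_inside[OF c(1)] c(2,3) by auto
    then show "winding_number P z \<noteq> winding_number Q z" using w by auto
  next
    assume "winding_number P z \<noteq> winding_number Q z"
    then have "winding_number ?c z \<noteq> 0" using w by simp
    then have "z \<notin> outside (path_image ?c)"
      using winding_number_zero_in_outside[of ?c z] c simple_path_imp_path by blast
    then show "z \<in> inside (path_image P \<union> path_image Q)"
      using z inside_Un_outside[of "path_image P \<union> path_image Q"] unfolding c(3) by blast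
  qed
qed

text \<open>\<open>S\<close> lies in one component of the complement of \<open>A\<close>, and
  \<open>inside\<close> asks only whether that component is bounded.\<close>

lemma mem_inside_connected:
  fixes S A :: "complex set"
  assumes "connected S" "S \<inter> A = {}" "x \<in> S" "y \<in> S" "x \<in> inside A"
  shows "y \<in> inside A"
proof -
  have "y \<in> connected_component_set (- A) x"
    using assms connected_component_maximal[of x S "- A"] by blast
  then have "connected_component_set (- A) y = connected_component_set (- A) x"
    by (rule connected_component_eq)
  then show ?thesis using assms by (auto simp: inside_def)
qed

text \<open>Each of the two insides is connected and misses the whole theta curve, so each contains
  the other once they share \<open>z\<close>. Equal insides have equal frontiers, which would put
  \<open>q\<close> on \<open>P\<close> or \<open>R\<close>.\<close>

lemma theta_curve_adjacent_faces:
  assumes th: "theta_curve a b P Q R"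
    and dQ: "path_image Q \<inter> inside (path_image P \<union> path_image R) = {}"
    and dR: "path_image R \<inter> inside (path_image P \<union> path_image Q) = {}"
    and q: "q \<in> path_image Q - {a, b}"
    and z: "z \<in> inside (path_image P \<union> path_image Q)" "z \<in> inside (path_image P \<union> path_image R)"
  shows False
proof -
  have th': "theta_curve a b P R Q"
    using th theta_curve_rotate theta_curve_swap by blast
  let ?PQ = "path_image P \<union> path_image Q" and ?PR = "path_image P \<union> path_image R"
  note PQ = theta_curve_loop[OF th] and PR = theta_curve_loop[OF th']
  have con: "connected (inside ?PQ)" "frontier (inside ?PQ) = ?PQ"
      "connected (inside ?PR)" "frontier (inside ?PR) = ?PR"
    using Jordan_inside_outside[OF PQ(1,2)] Jordan_inside_outside[OF PR(1,2)]
    unfolding PQ(3) PR(3) by simp_all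
  have "\<forall>x. x \<in> inside ?PQ \<longrightarrow> x \<notin> ?PR"
    using dR inside_no_overlap[of ?PQ] by (metis Un_iff disjoint_iff)
  then have dPQ: "inside ?PQ \<inter> ?PR = {}" by (simp only: disjoint_iff)
  have "\<forall>x. x \<in> inside ?PR \<longrightarrow> x \<notin> ?PQ"
    using dQ inside_no_overlap[of ?PR] by (metis Un_iff disjoint_iff)
  then have dPR: "inside ?PR \<inter> ?PQ = {}" by (simp only: disjoint_iff)
  have "inside ?PQ \<subseteq> inside ?PR"
    using mem_inside_connected[OF con(1) dPQ z(1) _ z(2)] by (rule subsetI)
  moreover have "inside ?PR \<subseteq> inside ?PQ"
    using mem_inside_connected[OF con(3) dPR z(2) _ z(1)] by (rule subsetI)
  ultimately have "frontier (inside ?PQ) = frontier (inside ?PR)"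
    by (intro arg_cong[of _ _ frontier] subset_antisym)
  then have "?PQ = ?PR" unfolding con(2,4) .
  moreover have "q \<in> ?PQ" using q by simp
  ultimately have "q \<in> ?PR" by (rule subst)
  then consider "q \<in> path_image P \<inter> path_image Q" | "q \<in> path_image Q \<inter> path_image R"
    using q by blast
  then show False
    using q th unfolding theta_curve_def by cases simp_all
qed

text \<open>The arc without its ends is connected and avoids the cycle, so it stays on the side of
  \<open>r\<close>; the ends lie on the cycle itself.\<close>

lemma theta_curve_arc_disjoint_inside:
  assumes th: "theta_curve a b P Q R"
    and r: "r \<in> path_image R - {a, b}" "r \<notin> inside (path_image P \<union> path_image Q)"
  shows "path_image R \<inter> inside (path_image P \<union> path_image Q) = {}"
proof -
  have ab: "a \<in> path_image P" "b \<in> path_image P" using th by (auto simp: theta_curve_def)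
  have "connected (path_image R - {a, b})"
    using th connected_simple_path_endless[of R] by (auto simp: theta_curve_def arc_imp_simple_path)
  moreover have "(path_image R - {a, b}) \<inter> (path_image P \<union> path_image Q) = {}"
    using th by (auto simp: theta_curve_def)
  ultimately have "x \<notin> inside (path_image P \<union> path_image Q)" if "x \<in> path_image R - {a, b}" for x
    using mem_inside_connected that r by blast
  moreover have "a \<notin> inside (path_image P \<union> path_image Q)" "b \<notin> inside (path_image P \<union> path_image Q)"
    using ab by (auto simp: inside_def)
  ultimately show ?thesis by blast
qed

text \<open>The signed winding numbers of the three cycles around a point add up to 0, so a point inside
  one cycle is inside a second one. If every arc were outside the cycle of the other two, both
  insides would be faces and hence equal, although their frontiers differ.\<close>

lemma theta_curve_some_arc_inside:
  assumes th: "theta_curve a b P Q R"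
    and p: "p \<in> path_image P - {a, b}" "p \<notin> inside (path_image Q \<union> path_image R)"
    and q: "q \<in> path_image Q - {a, b}" "q \<notin> inside (path_image P \<union> path_image R)"
    and r: "r \<in> path_image R - {a, b}" "r \<notin> inside (path_image P \<union> path_image Q)"
  shows False
proof -
  have thR: "theta_curve a b P Q R" and thQ: "theta_curve a b P R Q" and thP: "theta_curve a b Q R P"
    and th': "theta_curve a b Q P R"
    using th theta_curve_rotate theta_curve_swap by blast+
  have dR: "path_image R \<inter> inside (path_image P \<union> path_image Q) = {}"
    and dQ: "path_image Q \<inter> inside (path_image P \<union> path_image R) = {}"
    and dP: "path_image P \<inter> inside (path_image Q \<union> path_image R) = {}"
    using theta_curve_arc_disjoint_inside[OF thR r] theta_curve_arc_disjoint_inside[OF thQ q]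
      theta_curve_arc_disjoint_inside[OF thP p] by simp_all
  obtain z where z: "z \<in> inside (path_image P \<union> path_image Q)"
    using Jordan_inside_outside[OF theta_curve_loop(1,2)[OF th]] unfolding theta_curve_loop(3)[OF th]
    by blast
  then have "z \<notin> path_image P \<union> path_image Q" by (auto simp: inside_def)
  moreover have "z \<notin> path_image R" using z dR by auto
  ultimately have "z \<in> inside (path_image P \<union> path_image R) \<or> z \<in> inside (path_image Q \<union> path_image R)"
    using z theta_curve_winding[OF thR, of z] theta_curve_winding[OF thQ, of z]
      theta_curve_winding[OF thP, of z] by auto
  then show False
  proof
    assume "z \<in> inside (path_image P \<union> path_image R)"
    then show False by (rule theta_curve_adjacent_faces[OF th dQ dR q(1) z])
  next
    assume "z \<in> inside (path_image Q \<union> path_image R)"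
    moreover have "path_image R \<inter> inside (path_image Q \<union> path_image P) = {}"
      "z \<in> inside (path_image Q \<union> path_image P)"
      using dR z by (simp_all add: Un_commute)
    ultimately show False using theta_curve_adjacent_faces[OF th' dP _ p(1)] by metis
  qed
qed

text \<open>\<open>S\<close>, \<open>T\<close> and \<open>U\<close> join \<open>z\<close> to the
  three arcs; each may meet the arc it leads to, but neither of the others. Some arc, say that of
  \<open>p\<close>, runs inside the cycle of the other two, and so does \<open>z\<close>. That arc
  splits the inside into two parts, and the part with \<open>z\<close> also contains
  \<open>q\<close> or \<open>r\<close>, although both lie on the surrounding cycle.\<close>

lemma theta_curve_no_common_face:
  assumes th: "theta_curve a b P Q R"
    and p: "p \<in> path_image P - {a, b}" and q: "q \<in> path_image Q - {a, b}"
    and r: "r \<in> path_image R - {a, b}"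
    and z: "z \<notin> path_image P \<union> path_image Q \<union> path_image R"
    and S: "connected S" "z \<in> S" "p \<in> S" "S \<inter> (path_image Q \<union> path_image R) = {}"
    and T: "connected T" "z \<in> T" "q \<in> T" "T \<inter> (path_image P \<union> path_image R) = {}"
    and U: "connected U" "z \<in> U" "r \<in> U" "U \<inter> (path_image P \<union> path_image Q) = {}"
  shows False
proof -
  have thR: "theta_curve a b P Q R" and thQ: "theta_curve a b P R Q" and thP: "theta_curve a b Q R P"
    using th theta_curve_rotate theta_curve_swap by blast+
  let ?P = "path_image P" and ?Q = "path_image Q" and ?R = "path_image R"
  have Pz: "p \<in> inside (?Q \<union> ?R) \<longleftrightarrow> z \<in> inside (?Q \<union> ?R)"
    using mem_inside_connected[OF S(1,4)] S(2,3) by metis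
  have Qz: "q \<in> inside (?P \<union> ?R) \<longleftrightarrow> z \<in> inside (?P \<union> ?R)"
    using mem_inside_connected[OF T(1,4)] T(2,3) by metis
  have Rz: "r \<in> inside (?P \<union> ?Q) \<longleftrightarrow> z \<in> inside (?P \<union> ?Q)"
    using mem_inside_connected[OF U(1,4)] U(2,3) by metis
  have nP: "p \<notin> inside (?P \<union> ?Q)" "p \<notin> inside (?P \<union> ?R)"
    and nQ: "q \<notin> inside (?P \<union> ?Q)" "q \<notin> inside (?Q \<union> ?R)"
    and nR: "r \<notin> inside (?P \<union> ?R)" "r \<notin> inside (?Q \<union> ?R)"
    using p q r by (auto simp: inside_def)
  have com: "?R \<union> ?P = ?P \<union> ?R" "?R \<union> ?Q = ?Q \<union> ?R" "?Q \<union> ?P = ?P \<union> ?Q" by auto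
  consider "p \<in> inside (?Q \<union> ?R)" | "q \<in> inside (?P \<union> ?R)" | "r \<in> inside (?P \<union> ?Q)"
    using theta_curve_some_arc_inside[OF th p _ q _ r] by blast
  then show False
  proof cases
    case 1
    have "inside (?P \<union> ?Q) \<union> inside (?P \<union> ?R) \<union> (?P - {a, b}) = inside (?Q \<union> ?R)"
      using theta_curve_split[OF thP _ 1] p unfolding com by simp
    then show False using 1 Pz Qz Rz nQ(2) nR(2) z by blast
  next
    case 2
    have "inside (?P \<union> ?Q) \<union> inside (?Q \<union> ?R) \<union> (?Q - {a, b}) = inside (?P \<union> ?R)"
      using theta_curve_split[OF thQ _ 2] q unfolding com by simp
    then show False using 2 Pz Qz Rz nP(2) nR(1) z by blast
  next
    case 3
    have "inside (?P \<union> ?R) \<union> inside (?Q \<union> ?R) \<union> (?R - {a, b}) = inside (?P \<union> ?Q)"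
      using theta_curve_split[OF thR _ 3] r by simp
    then show False using 3 Pz Qz Rz nP(1) nQ(1) z by blast
  qed
qed

subsection \<open>Drawings and subdivisions\<close>

fun path_edges :: "'a list \<Rightarrow> 'a set set" where
  "path_edges [] = {}"
| "path_edges [x] = {}"
| "path_edges (x # y # xs) = insert {x, y} (path_edges (y # xs))"

text \<open>Lists with fewer than two vertices have no edges and hence empty image; this is the
  source of the bounds \<open>length xs \<ge> 2\<close> below.\<close>

definition trail_image :: "('a set \<Rightarrow> real \<Rightarrow> complex) \<Rightarrow> 'a list \<Rightarrow> complex set" where
  "trail_image curve xs = (\<Union>e \<in> path_edges xs. path_image (curve e))"

lemma path_edges_subset: "e \<in> path_edges xs \<Longrightarrow> e \<subseteq> set xs"
  by (induction xs rule: path_edges.induct) auto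

lemma path_edges_ne: "e \<in> path_edges xs \<Longrightarrow> e \<noteq> {}"
  by (induction xs rule: path_edges.induct) auto

lemma mem_path_edges_ex: "x \<in> set xs \<Longrightarrow> length xs \<ge> 2 \<Longrightarrow> \<exists>e \<in> path_edges xs. x \<in> e"
proof (induction xs rule: path_edges.induct)
  case (3 y z zs)
  then show ?case by (cases zs) auto
qed auto

locale drawing =
  fixes G :: "('a, 'b) pre_digraph" and pos curve
  assumes plane: "plane_drawing G pos curve"
begin

text \<open>The curve belongs to an unordered pair and may start at either end; it is reversed if it
  starts at \<open>pos v\<close>.\<close>

lemma edge_curve:
  assumes "{u, v} \<in> undirected_edges G" "u \<in> verts G" "v \<in> verts G" "u \<noteq> v"
  shows "\<exists>g. arc g \<and> pathstart g = pos u \<and> pathfinish g = pos v \<and> path_image g = path_image (curve {u, v})"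
proof -
  let ?c = "curve {u, v}"
  have c: "simple_path ?c" "{pathstart ?c, pathfinish ?c} = {pos u, pos v}"
    using plane assms(1) by (auto simp: plane_drawing_def)
  have ne: "pos u \<noteq> pos v" using plane assms by (auto simp: plane_drawing_def inj_on_def)
  have "arc ?c" using c ne by (auto simp: arc_simple_path doubleton_eq_iff)
  consider "pathstart ?c = pos u" "pathfinish ?c = pos v" | "pathstart ?c = pos v" "pathfinish ?c = pos u"
    using c(2) by (auto simp: doubleton_eq_iff)
  then show ?thesis
  proof cases
    case 1
    then show ?thesis using \<open>arc ?c\<close> by blast
  next
    case 2
    then show ?thesis using \<open>arc ?c\<close> by (intro exI[of _ "reversepath ?c"]) (simp add: arc_reversepath)
  qed
qed

lemma inj: "inj_on pos (verts G)"
  using plane by (simp add: plane_drawing_def)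

lemma curve_vertices:
  assumes "e \<in> undirected_edges G"
  shows "path_image (curve e) \<inter> pos ` verts G = pos ` e"
  using plane assms unfolding plane_drawing_def by simp

text \<open>A drawing controls intersections edge by edge. Only shared edges are excluded, because
  the three paths of a theta curve share their end vertices.\<close>

lemma trail_image_Int:
  assumes "path_edges xs \<subseteq> undirected_edges G" "path_edges ys \<subseteq> undirected_edges G"
    and "path_edges xs \<inter> path_edges ys = {}"
  shows "trail_image curve xs \<inter> trail_image curve ys \<subseteq> pos ` (set xs \<inter> set ys)"
proof
  fix p assume "p \<in> trail_image curve xs \<inter> trail_image curve ys"
  then obtain e f where ef: "e \<in> path_edges xs" "f \<in> path_edges ys"
      "p \<in> path_image (curve e) \<inter> path_image (curve f)"
    unfolding trail_image_def by blast
  then have "p \<in> pos ` (e \<inter> f)"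
    using plane assms unfolding plane_drawing_def by (metis disjoint_iff subsetD)
  then show "p \<in> pos ` (set xs \<inter> set ys)" using ef path_edges_subset by blast
qed

lemma pos_mem_trail_image:
  assumes "path_edges xs \<subseteq> undirected_edges G" "length xs \<ge> 2" "x \<in> set xs"
  shows "pos x \<in> trail_image curve xs"
proof -
  obtain e where e: "e \<in> path_edges xs" "x \<in> e"
    using mem_path_edges_ex[OF assms(3,2)] by (elim bexE)
  then have "pos x \<in> path_image (curve e)"
    using curve_vertices[of e] assms(1) by auto
  then show ?thesis using e(1) unfolding trail_image_def by blast
qed

lemma vertex_on_trail_image:
  assumes "path_edges xs \<subseteq> undirected_edges G" "set xs \<subseteq> verts G" "v \<in> verts G"
    and "pos v \<in> trail_image curve xs"
  shows "v \<in> set xs"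
proof -
  obtain e where e: "e \<in> path_edges xs" "pos v \<in> path_image (curve e)"
    using assms(4) unfolding trail_image_def by blast
  then have "pos v \<in> pos ` e"
    using curve_vertices[of e] assms(1,3) by auto
  moreover have "e \<subseteq> verts G" using path_edges_subset[OF e(1)] assms(2) by blast
  ultimately have "v \<in> e" 
    using inj assms(3) by (simp add: inj_on_image_mem_iff)
  then show ?thesis using path_edges_subset[OF e(1)] by blast
qed

text \<open>Edges are prepended one at a time. As the vertices are distinct, the new edge meets the
  rest of the path only in \<open>pos y\<close>, so the two arcs join to an arc.\<close>

lemma trail_arc:
  assumes "distinct xs" "length xs \<ge> 2" "set xs \<subseteq> verts G" "path_edges xs \<subseteq> undirected_edges G"
  shows "\<exists>g. arc g \<and> pathstart g = pos (hd xs) \<and> pathfinish g = pos (last xs) \<and>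
           path_image g = trail_image curve xs"
  using assms
proof (induction xs rule: path_edges.induct)
  case (3 x y zs)
  obtain h where h: "arc h" "pathstart h = pos x" "pathfinish h = pos y"
      "path_image h = path_image (curve {x, y})"
    using edge_curve[of x y] 3(2-) by auto
  show ?case
  proof (cases "zs = []")
    case True
    then show ?thesis using h by (auto simp: trail_image_def)
  next
    case False
    then have "length (y # zs) \<ge> 2" by (cases zs) auto
    then obtain g where g: "arc g" "pathstart g = pos y" "pathfinish g = pos (last (y # zs))"
        "path_image g = trail_image curve (y # zs)"
      using 3 by auto
    have "{x, y} \<notin> path_edges (y # zs)"
      using path_edges_subset[of "{x, y}" "y # zs"] 3(2) by auto
    then have "trail_image curve [x, y] \<inter> trail_image curve (y # zs) \<subseteq> pos ` (set [x, y] \<inter> set (y # zs))"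
      using 3(5) by (intro trail_image_Int) auto
    also have "set [x, y] \<inter> set (y # zs) = {y}" using 3(2) by auto
    also have "trail_image curve [x, y] = path_image h" using h by (simp add: trail_image_def)
    finally have "path_image h \<inter> path_image g \<subseteq> {pos y}" using g by simp
    then have "arc (h +++ g)" using h g by (intro arc_join) auto
    moreover have "path_image (h +++ g) = trail_image curve (x # y # zs)"
      using h g by (simp add: path_image_join trail_image_def)
    ultimately show ?thesis using h g by (intro exI[of _ "h +++ g"]) auto
  qed
qed auto

lemma trail_image_Int_eq:
  assumes "set xs \<subseteq> verts G" "path_edges xs \<subseteq> undirected_edges G" "length xs \<ge> 2"
    and "path_edges ys \<subseteq> undirected_edges G" "length ys \<ge> 2"
    and "path_edges xs \<inter> path_edges ys = {}"
  shows "trail_image curve xs \<inter> trail_image curve ys = pos ` (set xs \<inter> set ys)"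
  using trail_image_Int[OF assms(2,4,6)] pos_mem_trail_image[OF assms(2,3)]
    pos_mem_trail_image[OF assms(4,5)] by blast

text \<open>A subdivision of \<open>K\<^sub>3\<^sub>,\<^sub>3\<close>: the paths \<open>P\<close>, \<open>Q\<close>, \<open>R\<close> between two branch vertices of one
  class form a theta curve; the third vertex of that class is joined by \<open>S\<close>, \<open>T\<close>, \<open>U\<close> to the
  other class, which lies on \<open>P\<close>, \<open>Q\<close>, \<open>R\<close>.\<close>

lemma no_K33_subdivision:
  assumes trails: "\<And>xs. xs \<in> {P, Q, R, S, T, U} \<Longrightarrow>
      distinct xs \<and> length xs \<ge> 2 \<and> set xs \<subseteq> verts G \<and> path_edges xs \<subseteq> undirected_edges G"
    and hds: "hd P = a" "hd Q = a" "hd R = a" "hd S = z" "hd T = z" "hd U = z"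
    and lasts: "last P = b" "last Q = b" "last R = b" "last S = p" "last T = q" "last U = r"
    and theta: "set P \<inter> set Q = {a, b}" "set Q \<inter> set R = {a, b}" "set P \<inter> set R = {a, b}"
      "path_edges P \<inter> path_edges Q = {}" "path_edges Q \<inter> path_edges R = {}"
      "path_edges P \<inter> path_edges R = {}"
    and branch: "p \<in> set P - {a, b}" "q \<in> set Q - {a, b}" "r \<in> set R - {a, b}"
    and avoid: "set S \<inter> set Q = {}" "set S \<inter> set R = {}" "set T \<inter> set P = {}"
      "set T \<inter> set R = {}" "set U \<inter> set P = {}" "set U \<inter> set Q = {}"
  shows False
proof -
  let ?I = "trail_image curve" and ?L = "{P, Q, R, S, T, U}"
  have L: "P \<in> ?L" "Q \<in> ?L" "R \<in> ?L" "S \<in> ?L" "T \<in> ?L" "U \<in> ?L" by simp_all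
  have dis: "distinct xs" "length xs \<ge> 2" "set xs \<subseteq> verts G" "path_edges xs \<subseteq> undirected_edges G"
    if "xs \<in> ?L" for xs
    using trails[OF that] by simp_all
  note arc = trail_arc[OF dis]
  obtain gP where gP: "arc gP" "pathstart gP = pos a" "pathfinish gP = pos b" "path_image gP = ?I P"
    using arc[OF L(1,1,1,1)] unfolding hds lasts by (elim exE conjE)
  obtain gQ where gQ: "arc gQ" "pathstart gQ = pos a" "pathfinish gQ = pos b" "path_image gQ = ?I Q"
    using arc[OF L(2,2,2,2)] unfolding hds lasts by (elim exE conjE)
  obtain gR where gR: "arc gR" "pathstart gR = pos a" "pathfinish gR = pos b" "path_image gR = ?I R"
    using arc[OF L(3,3,3,3)] unfolding hds lasts by (elim exE conjE)
  have con: "connected (?I xs)" if "xs \<in> ?L" for xs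
    using arc[OF that that that that] by (elim exE conjE) (drule connected_arc_image, simp)
  have ends: "hd xs \<in> set xs" "last xs \<in> set xs" if "xs \<in> ?L" for xs
    using dis(2)[OF that] by (cases xs; simp)+
  have pos_in: "pos x \<in> ?I xs" if "xs \<in> ?L" "x \<in> set xs" for x xs
    by (rule pos_mem_trail_image[OF dis(4,2)[OF that(1)] that(2)])
  have a: "a \<in> verts G" using ends(1)[OF L(1)] dis(3)[OF L(1)] unfolding hds by (rule rev_subsetD)
  have b: "b \<in> verts G" using ends(2)[OF L(1)] dis(3)[OF L(1)] unfolding lasts by (rule rev_subsetD)
  have "a \<noteq> b"
    using dis(1,2)[OF L(1)] hds(1) lasts(1) by (cases P) (auto split: if_splits)
  have meet: "?I xs \<inter> ?I ys = pos ` (set xs \<inter> set ys)"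
    if "xs \<in> ?L" "ys \<in> ?L" "path_edges xs \<inter> path_edges ys = {}" for xs ys
    by (rule trail_image_Int_eq[OF dis(3,4,2)[OF that(1)] dis(4,2)[OF that(2)] that(3)])
  have "pos a \<noteq> pos b" using \<open>a \<noteq> b\<close> a b inj by (simp add: inj_on_eq_iff)
  then have th: "theta_curve (pos a) (pos b) gP gQ gR"
    unfolding theta_curve_def gP gQ gR meet[OF L(1,2) theta(4)] meet[OF L(2,3) theta(5)]
      meet[OF L(1,3) theta(6)] theta(1-3)
    using gP(1) gQ(1) gR(1) by simp
  \<comment> \<open>Vertex-disjoint lists share no edge, because an edge is a nonempty set of
    vertices of its list.\<close>
  have disj: "?I xs \<inter> ?I ys = {}" if "xs \<in> ?L" "ys \<in> ?L" "set xs \<inter> set ys = {}" for xs ys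
  proof -
    have "e \<notin> path_edges ys" if "e \<in> path_edges xs" for e
      using path_edges_subset[of e] path_edges_ne[OF that] that \<open>set xs \<inter> set ys = {}\<close> by blast
    then have "path_edges xs \<inter> path_edges ys = {}" by (simp add: disjoint_iff)
    then show ?thesis using meet[OF that(1,2)] that(3) by simp
  qed
  have branch_pos: "pos x \<in> ?I xs - {pos a, pos b}" if xs: "xs \<in> ?L" and x: "x \<in> set xs - {a, b}" for x xs
  proof -
    have "x \<in> verts G" using x dis(3)[OF xs] by auto
    then have "pos x \<noteq> pos a" "pos x \<noteq> pos b" using x a b inj by (auto simp: inj_on_eq_iff)
    then show ?thesis using pos_in[OF xs] x by auto
  qed
  have z_in: "z \<in> set S" "z \<in> set T" "z \<in> set U"
    using ends(1)[OF L(4)] ends(1)[OF L(5)] ends(1)[OF L(6)] unfolding hds by simp_all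
  have zG: "z \<in> verts G" using z_in(1) dis(3)[OF L(4)] by (rule rev_subsetD)
  have "z \<notin> set P" "z \<notin> set Q" "z \<notin> set R" using z_in avoid by (simp_all add: disjoint_iff)
  then have "pos z \<notin> ?I P" "pos z \<notin> ?I Q" "pos z \<notin> ?I R"
    using vertex_on_trail_image[OF dis(4,3)[OF L(1)] zG] vertex_on_trail_image[OF dis(4,3)[OF L(2)] zG]
      vertex_on_trail_image[OF dis(4,3)[OF L(3)] zG] by blast+
  then have z: "pos z \<notin> path_image gP \<union> path_image gQ \<union> path_image gR" unfolding gP gQ gR by simp
  have "?I S \<inter> (?I Q \<union> ?I R) = {}"
    using disj[OF L(4,2) avoid(1)] disj[OF L(4,3) avoid(2)] by (simp add: Int_Un_distrib)
  then have S: "connected (?I S)" "pos z \<in> ?I S" "pos p \<in> ?I S" "?I S \<inter> (path_image gQ \<union> path_image gR) = {}"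
    using con[OF L(4)] pos_in[OF L(4)] z_in(1) ends(2)[OF L(4)] unfolding gQ gR lasts by simp_all
  have "?I T \<inter> (?I P \<union> ?I R) = {}"
    using disj[OF L(5,1) avoid(3)] disj[OF L(5,3) avoid(4)] by (simp add: Int_Un_distrib)
  then have T: "connected (?I T)" "pos z \<in> ?I T" "pos q \<in> ?I T" "?I T \<inter> (path_image gP \<union> path_image gR) = {}"
    using con[OF L(5)] pos_in[OF L(5)] z_in(2) ends(2)[OF L(5)] unfolding gP gR lasts by simp_all
  have "?I U \<inter> (?I P \<union> ?I Q) = {}"
    using disj[OF L(6,1) avoid(5)] disj[OF L(6,2) avoid(6)] by (simp add: Int_Un_distrib)
  then have U: "connected (?I U)" "pos z \<in> ?I U" "pos r \<in> ?I U" "?I U \<inter> (path_image gP \<union> path_image gQ) = {}"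
    using con[OF L(6)] pos_in[OF L(6)] z_in(3) ends(2)[OF L(6)] unfolding gP gQ lasts by simp_all
  show False
    by (rule theta_curve_no_common_face[OF th _ _ _ z S T U])
      (use branch_pos[OF L(1) branch(1)] branch_pos[OF L(2) branch(2)] branch_pos[OF L(3) branch(3)]
        in \<open>simp_all only: gP gQ gR\<close>)
qed

end

section \<open>Transport of drawings along injections\<close>

text \<open>The drawing of \<open>G\<close> is restricted to the image of \<open>g\<close>. The
  hypothesis concerns undirected edges, so \<open>g\<close> may reverse arcs.\<close>

lemma planar_embedding:
  assumes "planar G" and "inj_on g (verts H)" and "g ` verts H \<subseteq> verts G"
    and "\<And>e. e \<in> undirected_edges H \<Longrightarrow> e \<subseteq> verts H \<and> g ` e \<in> undirected_edges G"
  shows "planar H"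
proof -
  obtain pos curve where d: "plane_drawing G pos curve" using assms(1) by (auto simp: planar_def)
  have "plane_drawing H (pos \<circ> g) (\<lambda>e. curve (g ` e))"
    unfolding plane_drawing_def
  proof (intro conjI ballI impI)
    show "inj_on (pos \<circ> g) (verts H)"
      by (rule comp_inj_on[OF assms(2) inj_on_subset[OF drawing.inj assms(3)]])
        (rule drawing.intro[OF d])
  next
    fix e assume e: "e \<in> undirected_edges H"
    note ge = assms(4)[OF e]
    have c: "simple_path (curve (g ` e))"
        "{pathstart (curve (g ` e)), pathfinish (curve (g ` e))} = pos ` g ` e"
        "path_image (curve (g ` e)) \<inter> pos ` verts G = pos ` g ` e"
      using d conjunct2[OF ge] unfolding plane_drawing_def by simp_all
    show "simple_path (curve (g ` e))" by (rule c)
    show "{pathstart (curve (g ` e)), pathfinish (curve (g ` e))} = (pos \<circ> g) ` e"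
      using c(2) by (simp add: image_comp)
    have restrict: "A \<inter> D = C" if "A \<inter> B = C" "C \<subseteq> D" "D \<subseteq> B" for A B C D :: "complex set"
      using that by blast
    show "path_image (curve (g ` e)) \<inter> (pos \<circ> g) ` verts H = (pos \<circ> g) ` e"
      unfolding image_comp[symmetric]
      by (rule restrict[OF c(3)]) (intro image_mono conjunct1[OF ge] assms(3))+
    fix f assume f: "f \<in> undirected_edges H" and "e \<noteq> f"
    note gf = assms(4)[OF f]
    have "g ` e \<noteq> g ` f" using \<open>e \<noteq> f\<close> ge gf assms(2) by (simp add: inj_on_image_eq_iff)
    then have "path_image (curve (g ` e)) \<inter> path_image (curve (g ` f)) \<subseteq> pos ` (g ` e \<inter> g ` f)"
      using d conjunct2[OF ge] conjunct2[OF gf] unfolding plane_drawing_def by simp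
    also have "g ` e \<inter> g ` f = g ` (e \<inter> f)" using ge gf assms(2) by (metis inj_on_image_Int)
    finally show "path_image (curve (g ` e)) \<inter> path_image (curve (g ` f)) \<subseteq> (pos \<circ> g) ` (e \<inter> f)"
      by (simp add: image_comp)
  qed
  then show ?thesis unfolding planar_def by blast
qed

subsection \<open>Words and Bruhat order\<close>

abbreviation tr :: "nat \<Rightarrow> nat \<Rightarrow> nat \<Rightarrow> nat" where "tr \<equiv> Transposition.transpose"

text \<open>The conjugation rule for transpositions, written without inverses.\<close>

lemma comp_transpose: "inj f \<Longrightarrow> f \<circ> tr i j = Transposition.transpose (f i) (f j) \<circ> f"
  by (auto simp: fun_eq_iff Transposition.transpose_def inj_eq)

lemma adj_word_prod_Nil [simp]: "adj_word_prod [] = id"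
  by (simp add: adj_word_prod_def)

lemma adj_word_prod_Cons [simp]: "adj_word_prod (i # xs) = tr i (Suc i) \<circ> adj_word_prod xs"
  by (simp add: adj_word_prod_def)

lemma adj_word_prod_append: "adj_word_prod (xs @ ys) = adj_word_prod xs \<circ> adj_word_prod ys"
  by (induction xs) (auto simp: comp_assoc)

lemma bij_adj_word_prod: "bij (adj_word_prod xs)"
  by (induction xs) (simp_all only: adj_word_prod_Nil adj_word_prod_Cons bij_id bij_comp bij_transpose)

lemma adjacent_transpose_less:
  assumes "i < j" "(i, j) \<noteq> (d, Suc d)"
  shows "tr d (Suc d) i < tr d (Suc d) j"
  using assms by (auto simp: Transposition.transpose_def)

section \<open>Strong exchange, length and Bruhat steps\<close>

text \<open>Induction on the last letter \<open>d\<close>. An inversion at \<open>(d, Suc d)\<close>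
  is removed by deleting \<open>d\<close>. Any other pair stays ordered under
  \<open>tr d (Suc d)\<close>, hence yields an inversion of the shorter word, and conjugation
  carries the deletion found there back.\<close>

lemma strong_exchange:
  assumes "i < j" "adj_word_prod xs i > adj_word_prod xs j"
  shows "\<exists>us d vs. xs = us @ d # vs \<and> adj_word_prod xs \<circ> tr i j = adj_word_prod (us @ vs)"
  using assms
proof (induction xs arbitrary: i j rule: rev_induct)
  case (snoc d xs)
  let ?s = "tr d (Suc d)"
  show ?case
  proof (cases "(i, j) = (d, Suc d)")
    case True
    then have "adj_word_prod (xs @ [d]) \<circ> tr i j = adj_word_prod xs"
      by (simp add: adj_word_prod_snoc comp_assoc)
    then show ?thesis by (intro exI[of _ xs] exI[of _ d] exI[of _ "[]"]) simp
  next
    case False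
    have "adj_word_prod xs (?s i) > adj_word_prod xs (?s j)"
      using snoc.prems(2) by (simp add: adj_word_prod_snoc)
    then obtain us e vs where w: "xs = us @ e # vs"
        "adj_word_prod xs \<circ> tr (?s i) (?s j) = adj_word_prod (us @ vs)"
      using snoc.IH adjacent_transpose_less[OF snoc.prems(1) False] by blast
    have "adj_word_prod (xs @ [d]) \<circ> tr i j = adj_word_prod xs \<circ> (?s \<circ> tr i j)"
      by (simp add: adj_word_prod_snoc comp_assoc)
    also have "?s \<circ> tr i j = tr (?s i) (?s j) \<circ> ?s" by (intro comp_transpose) simp
    also have "adj_word_prod xs \<circ> (tr (?s i) (?s j) \<circ> ?s) = adj_word_prod (us @ vs @ [d])"
      unfolding o_assoc w(2) by (simp add: adj_word_prod_append comp_assoc)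
    finally show ?thesis using w(1) by (intro exI[of _ us] exI[of _ e] exI[of _ "vs @ [d]"]) simp
  qed
qed simp

lemma permutes_comp_transpose:
  assumes "\<sigma> permutes {1..n}" "1 \<le> i" "i < j" "j \<le> n"
  shows "\<sigma> \<circ> tr i j permutes {1..n}"
  using assms by (intro permutes_compose[OF permutes_swap_id]) auto

text \<open>Strong exchange deletes a letter from a word that has as many letters as
  \<open>\<sigma>\<close> has inversions.\<close>

lemma perm_length_inversion_less:
  assumes \<sigma>: "\<sigma> permutes {1..n}" and ij: "1 \<le> i" "i < j" "j \<le> n" "\<sigma> i > \<sigma> j"
  shows "perm_length n (\<sigma> \<circ> tr i j) < perm_length n \<sigma>"
proof -
  obtain xs where xs: "length xs = card (inversions n \<sigma>)" "set xs \<subseteq> {1..<n}" "\<sigma> = adj_word_prod xs"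
    using ex_word_card_inversions[OF \<sigma>] by blast
  then obtain us d vs where del: "xs = us @ d # vs" "\<sigma> \<circ> tr i j = adj_word_prod (us @ vs)"
    using strong_exchange[OF ij(2)] ij(4) by blast
  have "card (inversions n (\<sigma> \<circ> tr i j)) \<le> length (us @ vs)"
    unfolding del(2) using xs(2) del(1) by (intro card_inversions_le_word) auto
  also have "\<dots> < length xs" using del(1) by simp
  finally show ?thesis
    using xs(1) perm_length_eq_card_inversions[OF \<sigma>]
      perm_length_eq_card_inversions[OF permutes_comp_transpose[OF \<sigma> ij(1-3)]] by simp
qed

text \<open>Replaces the comparison of lengths by one of two entries. If
  \<open>\<sigma> i < \<sigma> j\<close>, then \<open>\<tau>\<close> has an inversion at
  \<open>(i, j)\<close>, and exchanging back would make \<open>\<sigma>\<close> the shorter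
  one.\<close>

lemma bruhat_step_iff:
  assumes \<sigma>: "\<sigma> permutes {1..n}"
  shows "bruhat_step n \<tau> \<sigma> \<longleftrightarrow>
    (\<exists>i j. 1 \<le> i \<and> i < j \<and> j \<le> n \<and> \<sigma> i > \<sigma> j \<and> \<tau> = \<sigma> \<circ> tr i j)"
proof
  assume "bruhat_step n \<tau> \<sigma>"
  then obtain i j where ij: "1 \<le> i" "i < j" "j \<le> n" "\<tau> = \<sigma> \<circ> tr i j" and \<tau>: "\<tau> permutes {1..n}"
      and len: "perm_length n \<tau> < perm_length n \<sigma>"
    unfolding bruhat_step_def by blast
  have "\<sigma> i \<noteq> \<sigma> j" using permutes_inj[OF \<sigma>] ij(2) by (simp add: inj_eq)
  moreover have "\<not> \<sigma> i < \<sigma> j"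
  proof
    assume "\<sigma> i < \<sigma> j"
    then have "\<tau> i > \<tau> j" by (simp add: ij(4))
    from perm_length_inversion_less[OF \<tau> ij(1-3) this]
    moreover have "\<tau> \<circ> tr i j = \<sigma>"
      by (simp only: ij(4) comp_assoc transpose_comp_involutory comp_id)
    ultimately show False using len by simp
  qed
  ultimately show "\<exists>i j. 1 \<le> i \<and> i < j \<and> j \<le> n \<and> \<sigma> i > \<sigma> j \<and> \<tau> = \<sigma> \<circ> tr i j"
    using ij by (intro exI[of _ i] exI[of _ j]) auto
next
  assume "\<exists>i j. 1 \<le> i \<and> i < j \<and> j \<le> n \<and> \<sigma> i > \<sigma> j \<and> \<tau> = \<sigma> \<circ> tr i j"
  then show "bruhat_step n \<tau> \<sigma>"
    unfolding bruhat_step_def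
    using \<sigma> permutes_comp_transpose[OF \<sigma>] perm_length_inversion_less[OF \<sigma>] by blast
qed

lemma bruhat_le_permutes: "bruhat_le n \<tau> \<sigma> \<Longrightarrow> \<sigma> permutes {1..n} \<Longrightarrow> \<tau> permutes {1..n}"
  unfolding bruhat_le_def by (induction rule: converse_rtranclp_induct) (auto simp: bruhat_step_def)

lemma bruhat_le_refl: "bruhat_le n \<sigma> \<sigma>"
  by (simp add: bruhat_le_def)

lemma bruhat_le_trans: "bruhat_le n \<rho> \<tau> \<Longrightarrow> bruhat_le n \<tau> \<sigma> \<Longrightarrow> bruhat_le n \<rho> \<sigma>"
  by (simp add: bruhat_le_def)

lemma bruhat_le_inversion:
  assumes "\<sigma> permutes {1..n}" "1 \<le> i" "i < j" "j \<le> n" "\<sigma> i > \<sigma> j"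
  shows "bruhat_le n (\<sigma> \<circ> tr i j) \<sigma>"
  unfolding bruhat_le_def using bruhat_step_iff[OF assms(1)] assms by blast

text \<open>A form of the lifting property. Along a chain from \<open>\<tau>\<close> up to
  \<open>\<sigma>\<close>, right multiplication by \<open>tr d (Suc d)\<close> turns a step into a
  step again, unless it exchanges the positions \<open>d\<close> and \<open>Suc d\<close>; in that
  case the product is already the next member \<open>\<rho>\<close> of the chain.\<close>

lemma bruhat_le_lift:
  assumes "bruhat_le n \<tau> \<sigma>" and \<sigma>: "\<sigma> permutes {1..n}" and d: "1 \<le> d" "d < n"
  shows "bruhat_le n (\<tau> \<circ> tr d (Suc d)) \<sigma> \<or> bruhat_le n (\<tau> \<circ> tr d (Suc d)) (\<sigma> \<circ> tr d (Suc d))"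
  using assms(1) unfolding bruhat_le_def
proof (induction rule: converse_rtranclp_induct)
  case base
  then show ?case by simp
next
  case (step \<tau> \<rho>)
  let ?s = "tr d (Suc d)"
  have \<rho>: "\<rho> permutes {1..n}" using step(1) by (simp add: bruhat_step_def)
  obtain i j where ij: "1 \<le> i" "i < j" "j \<le> n" "\<rho> i > \<rho> j" "\<tau> = \<rho> \<circ> tr i j"
    using step(1) bruhat_step_iff[OF \<rho>] by blast
  show ?case
  proof (cases "(i, j) = (d, Suc d)")
    case True
    then have "\<tau> \<circ> ?s = \<rho>" by (simp add: ij(5) comp_assoc)
    then show ?thesis using step(2) by simp
  next
    case False
    have "\<rho> \<circ> ?s permutes {1..n}" using permutes_comp_transpose[OF \<rho>] d by simp
    moreover have "\<tau> \<circ> ?s = (\<rho> \<circ> ?s) \<circ> tr (?s i) (?s j)"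
    proof -
      have "?s \<circ> tr (?s i) (?s j) = tr i j \<circ> ?s" using comp_transpose[of ?s "?s i" "?s j"] by simp
      then show ?thesis by (simp add: ij(5) comp_assoc)
    qed
    moreover have "?s i < ?s j" by (rule adjacent_transpose_less[OF ij(2) False])
    moreover have "1 \<le> ?s i" "?s j \<le> n" using ij d by (auto simp: Transposition.transpose_def)
    moreover have "(\<rho> \<circ> ?s) (?s i) > (\<rho> \<circ> ?s) (?s j)" using ij(4) by simp
    ultimately have "bruhat_step n (\<tau> \<circ> ?s) (\<rho> \<circ> ?s)"
      using bruhat_step_iff[of "\<rho> \<circ> ?s" n] by blast
    then show ?thesis using step(3) by (meson converse_rtranclp_into_rtranclp)
  qed
qed

section \<open>Reduced words and the subword property\<close>

definition reduced_word :: "nat \<Rightarrow> nat list \<Rightarrow> bool" where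
  "reduced_word n xs \<longleftrightarrow> set xs \<subseteq> {1..<n} \<and> length xs = card (inversions n (adj_word_prod xs))"

text \<open>The full product has one inversion more than \<open>xs\<close> has letters. Hence
  \<open>d\<close> is an ascent of the product of \<open>xs\<close>: at a descent the last letter
  would have shortened it.\<close>

lemma reduced_word_snocD:
  assumes "reduced_word n (xs @ [d])"
  shows "reduced_word n xs" and "bruhat_le n (adj_word_prod xs) (adj_word_prod (xs @ [d]))"
proof -
  let ?p = "adj_word_prod xs" and ?s = "tr d (Suc d)"
  have d: "1 \<le> d" "d < n" and xs: "set xs \<subseteq> {1..<n}" using assms by (auto simp: reduced_word_def)
  have p: "?p permutes {1..n}" by (rule adj_word_prod_permutes[OF xs])
  have q: "?p \<circ> ?s permutes {1..n}" using permutes_comp_transpose[OF p] d by simp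
  have le: "card (inversions n ?p) \<le> length xs" by (rule card_inversions_le_word[OF xs])
  have eq: "card (inversions n (?p \<circ> ?s)) = Suc (length xs)"
    using assms by (simp add: reduced_word_def adj_word_prod_snoc)
  have "?p d \<noteq> ?p (Suc d)" using permutes_inj[OF p] by (simp add: inj_eq)
  moreover have "\<not> ?p d > ?p (Suc d)"
    using perm_length_inversion_less[OF p, of d "Suc d"] d eq le
    by (auto simp: perm_length_eq_card_inversions[OF p] perm_length_eq_card_inversions[OF q])
  ultimately have asc: "?p d < ?p (Suc d)" by simp
  then show "reduced_word n xs"
    using card_inversions_ascent[OF d asc] eq xs by (simp add: reduced_word_def)
  have "(?p \<circ> ?s) d > (?p \<circ> ?s) (Suc d)" using asc by simp
  then have "bruhat_le n ((?p \<circ> ?s) \<circ> ?s) (?p \<circ> ?s)"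
    using d by (intro bruhat_le_inversion[OF q]) auto
  then show "bruhat_le n ?p (adj_word_prod (xs @ [d]))" by (simp add: adj_word_prod_snoc comp_assoc)
qed

text \<open>One direction of the subword property. If the last letter is dropped,
  \<open>reduced_word_snocD\<close> leads back to the prefix; if it is kept,
  \<open>bruhat_le_lift\<close> applies.\<close>

lemma bruhat_le_subword:
  assumes "subseq ys xs" "reduced_word n xs"
  shows "bruhat_le n (adj_word_prod ys) (adj_word_prod xs)"
  using assms
proof (induction xs arbitrary: ys rule: rev_induct)
  case Nil
  then show ?case using list_emb_Nil2 bruhat_le_refl by metis
next
  case (snoc d xs)
  let ?s = "tr d (Suc d)"
  note r = reduced_word_snocD[OF snoc.prems(2)]
  obtain y1 y2 where y: "ys = y1 @ y2" "subseq y1 xs" "subseq y2 [d]"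
    using snoc.prems(1) by (auto simp: subseq_append_iff)
  have le: "bruhat_le n (adj_word_prod y1) (adj_word_prod xs)" using snoc.IH y(2) r(1) by blast
  consider "y2 = []" | "y2 = [d]" using y(3) by (cases y2) (auto split: if_splits)
  then show ?case
  proof cases
    case 1
    then show ?thesis using le r(2) y(1) bruhat_le_trans by simp
  next
    case 2
    have "1 \<le> d" "d < n" and xs: "set xs \<subseteq> {1..<n}" using snoc.prems(2) by (auto simp: reduced_word_def)
    then have "bruhat_le n (adj_word_prod y1 \<circ> ?s) (adj_word_prod xs) \<or>
        bruhat_le n (adj_word_prod y1 \<circ> ?s) (adj_word_prod xs \<circ> ?s)"
      using bruhat_le_lift[OF le adj_word_prod_permutes[OF xs]] by blast
    then show ?thesis
      using r(2) bruhat_le_trans unfolding y(1) 2 adj_word_prod_snoc by blast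
  qed
qed

section \<open>Repeated letters and the pattern 321\<close>

lemma adj_word_prod_commute:
  assumes "\<forall>e \<in> set xs. e \<noteq> d \<and> e \<noteq> Suc d \<and> d \<noteq> Suc e"
  shows "tr d (Suc d) \<circ> adj_word_prod xs = adj_word_prod xs \<circ> tr d (Suc d)"
  using assms
proof (induction xs)
  case (Cons e xs)
  \<comment> \<open>Here \<open>tr d (Suc d)\<close> fixes \<open>e\<close> and
    \<open>Suc e\<close>, so conjugation leaves the other transposition unchanged.\<close>
  have "tr d (Suc d) \<circ> tr e (Suc e) = tr e (Suc e) \<circ> tr d (Suc d)"
    using Cons.prems comp_transpose[of "tr d (Suc d)" e "Suc e"]
    by (simp add: Transposition.transpose_def)
  moreover have "tr d (Suc d) \<circ> adj_word_prod xs = adj_word_prod xs \<circ> tr d (Suc d)"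
    using Cons.prems by (intro Cons.IH) simp
  ultimately show ?case unfolding adj_word_prod_Cons by (metis comp_assoc)
qed simp

text \<open>Take two equal letters \<open>d\<close> as close together as possible, so that no
  \<open>d\<close> lies between them. Without a neighbour \<open>d - 1\<close> or
  \<open>d + 1\<close> in between, one could be moved next to the other by commutation and both
  would cancel, contradicting reducedness.\<close>

lemma reduced_word_repetition:
  assumes red: "reduced_word n xs" and "\<not> distinct xs"
  shows "\<exists>d e. (e = Suc d \<or> d = Suc e) \<and> subseq [d, e, d] xs"
proof -
  define R where "R = (\<lambda>k. \<exists>as d bs cs. xs = as @ [d] @ bs @ [d] @ cs \<and> length bs = k)"
  have "\<exists>k. R k" using not_distinct_decomp[OF assms(2)] unfolding R_def by blast
  then have "R (LEAST k. R k)" by (rule LeastI_ex)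
  then obtain as d bs cs where dec: "xs = as @ [d] @ bs @ [d] @ cs" "length bs = (LEAST k. R k)"
    unfolding R_def by blast
  have "d \<notin> set bs"
  proof
    assume "d \<in> set bs"
    then obtain us vs where bs: "bs = us @ d # vs" by (meson split_list)
    then have "R (length us)"
      unfolding R_def dec(1) by (intro exI[of _ as] exI[of _ d] exI[of _ us] exI[of _ "vs @ [d] @ cs"]) simp
    then have "length bs \<le> length us" unfolding dec(2) by (rule Least_le)
    then show False using bs by simp
  qed
  have "\<exists>e \<in> set bs. e = Suc d \<or> d = Suc e"
  proof (rule ccontr)
    assume "\<not> ?thesis"
    then have "\<forall>e \<in> set bs. e \<noteq> d \<and> e \<noteq> Suc d \<and> d \<noteq> Suc e" using \<open>d \<notin> set bs\<close> by auto
    from adj_word_prod_commute[OF this]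
    have "tr d (Suc d) \<circ> adj_word_prod bs \<circ> tr d (Suc d) = adj_word_prod bs"
      by (simp only: comp_assoc transpose_comp_involutory comp_id)
    then have "adj_word_prod xs = adj_word_prod (as @ bs @ cs)"
      unfolding dec(1) adj_word_prod_append adj_word_prod_Cons adj_word_prod_Nil comp_id
      by (metis comp_assoc)
    moreover have "card (inversions n (adj_word_prod (as @ bs @ cs))) \<le> length (as @ bs @ cs)"
      using red by (intro card_inversions_le_word) (auto simp: reduced_word_def dec(1))
    ultimately show False using red by (simp add: reduced_word_def dec(1))
  qed
  then obtain e where e: "e \<in> set bs" "e = Suc d \<or> d = Suc e" by blast
  have "subseq ([] @ [d] @ [e] @ [d] @ []) xs"
    unfolding dec(1) using e(1) by (intro list_emb_append_mono) (auto simp: subseq_singleton_left)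
  then show ?thesis using e(2) by auto
qed

text \<open>The embedding of the pattern is written out as three positions;
  \<open>perm_contains_321_iff\<close> ties this to \<open>perm_contains\<close>.\<close>

definition has_321 :: "nat \<Rightarrow> (nat \<Rightarrow> nat) \<Rightarrow> bool" where
  "has_321 n \<sigma> \<longleftrightarrow> (\<exists>i j k. 1 \<le> i \<and> i < j \<and> j < k \<and> k \<le> n \<and> \<sigma> i > \<sigma> j \<and> \<sigma> j > \<sigma> k)"

text \<open>By the braid relation the product depends only on \<open>i = min d e\<close>: it
  exchanges \<open>i\<close> and \<open>i + 2\<close> and fixes \<open>i + 1\<close>.\<close>

lemma has_321_braid:
  assumes "e = Suc d \<or> d = Suc e" "{d, e} \<subseteq> {1..<n}"
  shows "has_321 n (adj_word_prod [d, e, d])"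
proof -
  define i where "i = min d e"
  have "1 \<le> i" "i + 2 \<le> n" and "(d, e) = (i, Suc i) \<or> (d, e) = (Suc i, i)"
    using assms by (auto simp: i_def)
  moreover have "adj_word_prod [d, e, d] i = Suc (Suc i)" "adj_word_prod [d, e, d] (Suc i) = Suc i"
      "adj_word_prod [d, e, d] (Suc (Suc i)) = i"
    using calculation(3) by (elim disjE; simp add: Transposition.transpose_def)+
  ultimately show ?thesis
    unfolding has_321_def
    by (intro exI[of _ i] exI[of _ "Suc i"] exI[of _ "Suc (Suc i)"]) simp
qed

section \<open>Words with distinct letters\<close>

text \<open>Among adjacent transpositions only \<open>tr d (Suc d)\<close> moves a number across the
  cut between \<open>d\<close> and \<open>Suc d\<close>.\<close>

lemma adj_word_prod_le_iff: "d \<notin> set xs \<Longrightarrow> adj_word_prod xs x \<le> d \<longleftrightarrow> x \<le> d"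
proof (induction xs)
  case (Cons e xs)
  have "tr e (Suc e) y \<le> d \<longleftrightarrow> y \<le> d" for y
    using Cons.prems by (auto simp: Transposition.transpose_def)
  then show ?case using Cons by simp
qed simp

text \<open>Lets the letters be read off from the permutation. The single occurrence of
  \<open>d\<close> lifts one number over the cut after \<open>d\<close>, and no other letter moves
  anything across it.\<close>

lemma mem_distinct_word_iff:
  assumes "distinct xs"
  shows "d \<in> set xs \<longleftrightarrow> (\<exists>x \<le> d. adj_word_prod xs x > d)"
proof
  assume "d \<in> set xs"
  then obtain us vs where xs: "xs = us @ d # vs" by (meson split_list)
  then have ns: "d \<notin> set us" "d \<notin> set vs" using assms by auto
  \<comment> \<open>\<open>x\<close> is the number that the letters right of \<open>d\<close> send
    to \<open>d\<close>, hence the one lifted to \<open>Suc d\<close>.\<close>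
  obtain x where x: "adj_word_prod vs x = d" using bij_is_surj[OF bij_adj_word_prod[of vs]] by (metis surjD)
  then have "x \<le> d" using adj_word_prod_le_iff[OF ns(2), of x] by simp
  moreover have "adj_word_prod us (Suc d) > d" using adj_word_prod_le_iff[OF ns(1), of "Suc d"] by simp
  then have "adj_word_prod xs x > d" using x by (simp add: xs adj_word_prod_append)
  ultimately show "\<exists>x \<le> d. adj_word_prod xs x > d" by blast
next
  assume "\<exists>x \<le> d. adj_word_prod xs x > d"
  then show "d \<in> set xs" using adj_word_prod_le_iff[of d xs] by (metis linorder_not_le)
qed

text \<open>A subword of a distinct word is determined by its set of letters, so sets can index the
  vertices of the cube.\<close>

definition subword_prod :: "nat list \<Rightarrow> nat set \<Rightarrow> nat \<Rightarrow> nat" where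
  "subword_prod xs A = adj_word_prod (filter (\<lambda>x. x \<in> A) xs)"

lemma inj_on_subword_prod:
  assumes "distinct xs"
  shows "inj_on (subword_prod xs) (Pow (set xs))"
proof (rule inj_onI)
  fix A B assume AB: "A \<in> Pow (set xs)" "B \<in> Pow (set xs)" "subword_prod xs A = subword_prod xs B"
  have "set (filter (\<lambda>x. x \<in> C) xs) = {d. \<exists>x \<le> d. subword_prod xs C x > d}" for C
    unfolding subword_prod_def
    by (intro set_eqI, subst mem_distinct_word_iff) (use assms in simp_all)
  then have "set (filter (\<lambda>x. x \<in> A) xs) = set (filter (\<lambda>x. x \<in> B) xs)" using AB(3) by simp
  then show "A = B" using AB(1,2) by auto
qed

lemma subword_prod_delete:
  assumes "distinct xs" "filter (\<lambda>x. x \<in> A) xs = us @ d # vs"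
  shows "d \<in> A" "subword_prod xs (A - {d}) = adj_word_prod (us @ vs)"
proof -
  have "d \<in> set (filter (\<lambda>x. x \<in> A) xs)" unfolding assms(2) by simp
  then show "d \<in> A" by simp
  have "distinct (us @ d # vs)" using assms by (metis distinct_filter)
  then have "us @ vs = filter (\<lambda>x. x \<noteq> d) (us @ d # vs)"
    by (auto simp: filter_id_conv intro!: arg_cong2[where f = append] sym[OF filter_True])
  also have "\<dots> = filter (\<lambda>x. x \<in> A - {d}) xs"
    unfolding assms(2)[symmetric] by (auto intro: filter_cong)
  finally show "subword_prod xs (A - {d}) = adj_word_prod (us @ vs)"
    by (simp add: subword_prod_def)
qed

text \<open>Strong exchange deletes a letter of the subword; as letters are distinct, this removes
  one element of \<open>A\<close>.\<close>

lemma bruhat_step_subword_prod: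
  assumes xs: "distinct xs" "set xs \<subseteq> {1..<n}" and st: "bruhat_step n \<tau> (subword_prod xs A)"
  shows "\<exists>d \<in> A. \<tau> = subword_prod xs (A - {d})"
proof -
  let ?ys = "filter (\<lambda>x. x \<in> A) xs"
  have "subword_prod xs A permutes {1..n}"
    unfolding subword_prod_def using xs by (intro adj_word_prod_permutes) auto
  then obtain i j where ij: "i < j" "subword_prod xs A i > subword_prod xs A j" "\<tau> = subword_prod xs A \<circ> tr i j"
    using st bruhat_step_iff by blast
  then obtain us d vs where "?ys = us @ d # vs" "\<tau> = adj_word_prod (us @ vs)"
    using strong_exchange[of i j ?ys] unfolding subword_prod_def by auto
  then show ?thesis using subword_prod_delete[OF xs(1)] by metis
qed

lemma bruhat_le_subword_prod:
  assumes xs: "distinct xs" "set xs \<subseteq> {1..<n}" and "bruhat_le n \<tau> (adj_word_prod xs)"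
  shows "\<exists>A \<subseteq> set xs. \<tau> = subword_prod xs A"
  using assms(3) unfolding bruhat_le_def
proof (induction rule: converse_rtranclp_induct)
  case base
  show ?case by (intro exI[of _ "set xs"]) (simp add: subword_prod_def)
next
  case (step \<tau> \<rho>)
  then obtain A where A: "A \<subseteq> set xs" "\<rho> = subword_prod xs A" by blast
  then obtain d where "\<tau> = subword_prod xs (A - {d})"
    using bruhat_step_subword_prod[OF xs, of \<tau> A] step(1) by blast
  then show ?case using A(1) by (intro exI[of _ "A - {d}"]) auto
qed

text \<open>Deleting \<open>d\<close> multiplies on the right by a conjugate of
  \<open>tr d (Suc d)\<close>. Lengths are not compared here; \<open>transpose_edge\<close> finds
  the direction of the step.\<close>

lemma subword_prod_delete_transpose:
  assumes xs: "distinct xs" "set xs \<subseteq> {1..<n}" and d: "d \<in> A" "d \<in> set xs"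
  shows "\<exists>i j. 1 \<le> i \<and> i < j \<and> j \<le> n \<and> subword_prod xs (A - {d}) = subword_prod xs A \<circ> tr i j"
proof -
  have "d \<in> set (filter (\<lambda>x. x \<in> A) xs)" using d by simp
  then obtain us vs where dec: "filter (\<lambda>x. x \<in> A) xs = us @ d # vs" by (meson split_list)
  have "set (us @ d # vs) \<subseteq> {1..<n}" unfolding dec[symmetric] using xs(2) by auto
  then have dn: "1 \<le> d" "d < n" and vs: "set vs \<subseteq> {1..<n}" by auto
  note v = adj_word_prod_permutes[OF vs]
  \<comment> \<open>The positions that the letters after \<open>d\<close> send to \<open>d\<close>
    and \<open>Suc d\<close>. Their order is left open, hence \<open>min\<close> and
    \<open>max\<close> below.\<close>
  obtain x y where xy: "adj_word_prod vs x = d" "adj_word_prod vs y = Suc d"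
    using bij_is_surj[OF bij_adj_word_prod[of vs]] by (metis surjD)
  have "x \<in> {1..n}" "y \<in> {1..n}"
    using permutes_in_image[OF v, of x] permutes_in_image[OF v, of y] xy dn by auto
  have "x \<noteq> y" using xy by auto
  have "tr d (Suc d) \<circ> adj_word_prod vs = adj_word_prod vs \<circ> tr x y"
    using comp_transpose[OF permutes_inj[OF v], of x y] xy by simp
  then have "subword_prod xs A \<circ> tr x y = subword_prod xs (A - {d})"
    unfolding subword_prod_delete(2)[OF xs(1) dec] unfolding subword_prod_def dec adj_word_prod_append
      adj_word_prod_Cons by (simp only: comp_assoc transpose_comp_involutory comp_id)
  then have "subword_prod xs (A - {d}) = subword_prod xs A \<circ> tr (min x y) (max x y)"
    by (simp add: min_def max_def transpose_commute)
  then show ?thesis using \<open>x \<in> {1..n}\<close> \<open>y \<in> {1..n}\<close> \<open>x \<noteq> y\<close>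
    by (intro exI[of _ "min x y"] exI[of _ "max x y"]) auto
qed

subsection \<open>Planarity of lower Bruhat graphs\<close>

lemma verts_lower_bruhat_graph:
  assumes "\<sigma> permutes {1..n}"
  shows "verts (lower_bruhat_graph n \<sigma>) = {\<tau>. bruhat_le n \<tau> \<sigma>}"
  using bruhat_le_permutes[OF _ assms]
  by (auto simp: lower_bruhat_graph_def bruhat_graph_def)

text \<open>The lower end of a step is below \<open>\<sigma>\<close> as soon as the upper end is, so
  the upper end alone describes the induced edges.\<close>

lemma undirected_edges_lower_bruhat_graph:
  assumes "\<sigma> permutes {1..n}"
  shows "undirected_edges (lower_bruhat_graph n \<sigma>) =
    {{\<rho>, \<tau>} | \<rho> \<tau>. bruhat_step n \<rho> \<tau> \<and> bruhat_le n \<tau> \<sigma>}"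
proof -
  have "bruhat_le n \<rho> \<sigma>" if "bruhat_step n \<rho> \<tau>" "bruhat_le n \<tau> \<sigma>" for \<rho> \<tau>
    using that unfolding bruhat_le_def by (rule converse_rtranclp_into_rtranclp)
  then have "arcs (lower_bruhat_graph n \<sigma>) = {(\<rho>, \<tau>). bruhat_step n \<rho> \<tau> \<and> bruhat_le n \<tau> \<sigma>}"
    using bruhat_le_permutes[OF _ assms]
    by (auto simp: lower_bruhat_graph_def bruhat_graph_def induce_subgraph_def)
  moreover have "tail (lower_bruhat_graph n \<sigma>) = fst" "head (lower_bruhat_graph n \<sigma>) = snd"
    by (simp_all add: lower_bruhat_graph_def)
  ultimately show ?thesis
    unfolding undirected_edges_def by (auto simp: image_def)
qed

text \<open>Exactly one of the two permutations has an inversion at \<open>(i, j)\<close>, so there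
  is a step in one direction, and undirected edges forget which.\<close>

lemma transpose_edge:
  assumes \<sigma>: "\<sigma> permutes {1..n}" and le: "bruhat_le n \<rho> \<sigma>" "bruhat_le n \<tau> \<sigma>"
    and ij: "1 \<le> i" "i < j" "j \<le> n" "\<tau> = \<rho> \<circ> tr i j"
  shows "{\<rho>, \<tau>} \<in> undirected_edges (lower_bruhat_graph n \<sigma>)"
proof -
  have perm: "\<rho> permutes {1..n}" "\<tau> permutes {1..n}" using le bruhat_le_permutes \<sigma> by blast+
  have \<rho>: "\<rho> = \<tau> \<circ> tr i j" by (simp only: ij(4) comp_assoc transpose_comp_involutory comp_id)
  have "\<rho> i \<noteq> \<rho> j" using permutes_inj[OF perm(1)] ij(2) by (simp add: inj_eq)
  then consider "\<rho> i > \<rho> j" | "\<tau> i > \<tau> j" using ij(4) by fastforce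
  then have "bruhat_step n \<tau> \<rho> \<or> bruhat_step n \<rho> \<tau>"
    using bruhat_step_iff[OF perm(1)] bruhat_step_iff[OF perm(2)] ij \<rho> by metis
  then show ?thesis
    unfolding undirected_edges_lower_bruhat_graph[OF \<sigma>] using le by (auto simp: insert_commute)
qed

lemma planar_lower_bruhat_graph_mono:
  assumes "planar (lower_bruhat_graph n \<sigma>)" and \<sigma>: "\<sigma> permutes {1..n}" and le: "bruhat_le n \<tau> \<sigma>"
  shows "planar (lower_bruhat_graph n \<tau>)"
proof -
  have \<tau>: "\<tau> permutes {1..n}" by (rule bruhat_le_permutes[OF le \<sigma>])
  have step: "bruhat_le n \<rho> \<tau>" if "bruhat_step n \<rho> \<upsilon>" "bruhat_le n \<upsilon> \<tau>" for \<rho> \<upsilon>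
    using that unfolding bruhat_le_def by (rule converse_rtranclp_into_rtranclp)
  show ?thesis
  proof (rule planar_embedding[OF assms(1), of id])
    show "id ` verts (lower_bruhat_graph n \<tau>) \<subseteq> verts (lower_bruhat_graph n \<sigma>)"
      unfolding verts_lower_bruhat_graph[OF \<sigma>] verts_lower_bruhat_graph[OF \<tau>]
      using bruhat_le_trans[OF _ le] by (simp add: subset_iff)
    show "e \<subseteq> verts (lower_bruhat_graph n \<tau>) \<and> id ` e \<in> undirected_edges (lower_bruhat_graph n \<sigma>)"
      if edge: "e \<in> undirected_edges (lower_bruhat_graph n \<tau>)" for e
    proof -
      obtain \<rho> \<upsilon> where e: "e = {\<rho>, \<upsilon>}" "bruhat_step n \<rho> \<upsilon>" "bruhat_le n \<upsilon> \<tau>"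
        using edge unfolding undirected_edges_lower_bruhat_graph[OF \<tau>] by blast
      then show ?thesis
        unfolding undirected_edges_lower_bruhat_graph[OF \<sigma>] verts_lower_bruhat_graph[OF \<tau>]
        using step bruhat_le_trans[OF e(3) le] by auto
    qed
  qed simp
qed

section \<open>Permutations containing 321\<close>

text \<open>The classes are \<open>a, b, z\<close> and \<open>p, q, r\<close>: the paths from
  \<open>a\<close> to \<open>b\<close> pass through \<open>p\<close>, \<open>q\<close>,
  \<open>r\<close>, and \<open>z\<close> is joined to these by single edges.\<close>

lemma K33_not_planar:
  assumes V: "{a, b, z, p, q, r} \<subseteq> verts G" and dist: "distinct [a, b, z, p, q, r]"
    and E: "{{a, p}, {a, q}, {a, r}, {b, p}, {b, q}, {b, r}, {z, p}, {z, q}, {z, r}} \<subseteq> undirected_edges G"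
  shows "\<not> planar G"
proof
  assume "planar G"
  then obtain pos curve where "drawing G pos curve" by (auto simp: planar_def drawing_def)
  then interpret drawing G pos curve .
  show False
    by (rule no_K33_subdivision[of "[a, p, b]" "[a, q, b]" "[a, r, b]" "[z, p]" "[z, q]" "[z, r]" a z b p q r])
      (use V dist E in \<open>auto simp: insert_commute doubleton_eq_iff\<close>)
qed

lemma has_321_not_planar:
  assumes \<sigma>: "\<sigma> permutes {1..n}" and "has_321 n \<sigma>"
  shows "\<not> planar (lower_bruhat_graph n \<sigma>)"
proof -
  obtain i j k where ijk: "1 \<le> i" "i < j" "j < k" "k \<le> n" and inv: "\<sigma> i > \<sigma> j" "\<sigma> j > \<sigma> k"
    using assms(2) unfolding has_321_def by blast
  \<comment> \<open>\<open>p\<close>, \<open>q\<close> and \<open>r\<close> exchange two of the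
    three entries; \<open>b\<close> and \<open>z\<close> are the two cyclic rearrangements and form
    the other class together with \<open>\<sigma>\<close>.\<close>
  define p q r where pqr: "p = \<sigma> \<circ> tr i j" "q = \<sigma> \<circ> tr j k" "r = \<sigma> \<circ> tr i k"
  define b z where bz: "b = p \<circ> tr j k" "z = q \<circ> tr i j"
  \<comment> \<open>With the definitions, \<open>b\<close> and \<open>z\<close> are each one
    transposition away from every one of \<open>p\<close>, \<open>q\<close>,
    \<open>r\<close>.\<close>
  have edges: "b = q \<circ> tr i k" "b = r \<circ> tr i j" "z = p \<circ> tr i k" "z = r \<circ> tr j k"
    using ijk by (auto simp: bz pqr fun_eq_iff Transposition.transpose_def)
  have pq: "p permutes {1..n}" "q permutes {1..n}"
    unfolding pqr using ijk by (intro permutes_comp_transpose[OF \<sigma>]; simp)+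
  have le: "bruhat_le n p \<sigma>" "bruhat_le n q \<sigma>" "bruhat_le n r \<sigma>"
    unfolding pqr using ijk inv by (intro bruhat_le_inversion[OF \<sigma>]; simp)+
  have "p j > p k" "q i > q j" using ijk inv by (auto simp: pqr Transposition.transpose_def)
  then have "bruhat_le n b p" "bruhat_le n z q"
    unfolding bz using ijk
    by (intro bruhat_le_inversion[OF pq(1)] bruhat_le_inversion[OF pq(2)]; simp)+
  then have le': "bruhat_le n b \<sigma>" "bruhat_le n z \<sigma>" using le bruhat_le_trans by blast+
  note edge = transpose_edge[OF \<sigma>]
  show ?thesis
  proof (rule K33_not_planar[of \<sigma> b z p q r])
    show "{\<sigma>, b, z, p, q, r} \<subseteq> verts (lower_bruhat_graph n \<sigma>)"
      using le le' bruhat_le_refl by (simp add: verts_lower_bruhat_graph[OF \<sigma>])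
    \<comment> \<open>The entries at \<open>i\<close> and \<open>j\<close> alone tell the six
      rearrangements apart.\<close>
    have "distinct (map (\<lambda>f. (f i, f j)) [\<sigma>, b, z, p, q, r])"
      using ijk inv by (simp add: bz pqr Transposition.transpose_def)
    then show "distinct [\<sigma>, b, z, p, q, r]" by (simp only: distinct_map)
    have "{\<sigma>, p} \<in> undirected_edges (lower_bruhat_graph n \<sigma>)"
      "{\<sigma>, q} \<in> undirected_edges (lower_bruhat_graph n \<sigma>)"
      "{\<sigma>, r} \<in> undirected_edges (lower_bruhat_graph n \<sigma>)"
      using edge[OF bruhat_le_refl le(1) _ _ _ pqr(1)] edge[OF bruhat_le_refl le(2) _ _ _ pqr(2)]
        edge[OF bruhat_le_refl le(3) _ _ _ pqr(3)] ijk by simp_all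
    moreover have "{p, b} \<in> undirected_edges (lower_bruhat_graph n \<sigma>)"
      "{q, b} \<in> undirected_edges (lower_bruhat_graph n \<sigma>)"
      "{r, b} \<in> undirected_edges (lower_bruhat_graph n \<sigma>)"
      using edge[OF le(1) le'(1) _ _ _ bz(1)] edge[OF le(2) le'(1) _ _ _ edges(1)]
        edge[OF le(3) le'(1) _ _ _ edges(2)] ijk by simp_all
    moreover have "{p, z} \<in> undirected_edges (lower_bruhat_graph n \<sigma>)"
      "{q, z} \<in> undirected_edges (lower_bruhat_graph n \<sigma>)"
      "{r, z} \<in> undirected_edges (lower_bruhat_graph n \<sigma>)"
      using edge[OF le(1) le'(2) _ _ _ edges(3)] edge[OF le(2) le'(2) _ _ _ bz(2)]
        edge[OF le(3) le'(2) _ _ _ edges(4)] ijk by simp_all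
    ultimately show "{{\<sigma>, p}, {\<sigma>, q}, {\<sigma>, r}, {b, p}, {b, q}, {b, r}, {z, p}, {z, q}, {z, r}}
        \<subseteq> undirected_edges (lower_bruhat_graph n \<sigma>)"
      by (simp add: insert_commute)
  qed
qed

section \<open>The cube of dimension four\<close>

text \<open>Two vertices of a cube have at most two common neighbours, so
  \<open>K\<^sub>3\<^sub>,\<^sub>3\<close> appears in it only with subdivided edges.\<close>

lemma Q4_not_planar:
  fixes g :: "bool \<Rightarrow> bool \<Rightarrow> bool \<Rightarrow> bool \<Rightarrow> 'a" and G :: "('a, 'b) pre_digraph"
  assumes V: "\<And>w x y z. g w x y z \<in> verts G"
    and g_eq: "\<And>w x y z w' x' y' z'. g w x y z = g w' x' y' z' \<longleftrightarrow> w = w' \<and> x = x' \<and> y = y' \<and> z = z'"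
    and E: "\<And>x y z. {g True x y z, g False x y z} \<in> undirected_edges G"
      "\<And>w y z. {g w True y z, g w False y z} \<in> undirected_edges G"
      "\<And>w x z. {g w x True z, g w x False z} \<in> undirected_edges G"
      "\<And>w x y. {g w x y True, g w x y False} \<in> undirected_edges G"
  shows "\<not> planar G"
proof
  assume "planar G"
  then obtain pos curve where "drawing G pos curve" by (auto simp: planar_def drawing_def)
  then interpret drawing G pos curve .
  have E': "{g False x y z, g True x y z} \<in> undirected_edges G"
      "{g w False y z, g w True y z} \<in> undirected_edges G"
      "{g w x False z, g w x True z} \<in> undirected_edges G"
      "{g w x y False, g w x y True} \<in> undirected_edges G" for w x y z
    using E by (simp_all add: insert_commute)
  \<comment> \<open>\<open>?v m\<close> is the vertex whose coordinates are the binary digits of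
    \<open>m\<close>, lowest first. The branch vertices are 0, 1, 6 on one side and 2, 4, 8 on the
    other; 3, 5, 9, 10 and 14 subdivide the paths.\<close>
  let ?v = "\<lambda>m. g (odd m) (odd (m div 2)) (odd (m div 4)) (odd (m div 8 :: nat))"
  let ?P = "map ?v [0, 2, 3, 1]" and ?Q = "map ?v [0, 4, 5, 1]" and ?R = "map ?v [0, 8, 9, 1]"
    and ?S = "map ?v [6, 2]" and ?T = "map ?v [6, 4]" and ?U = "map ?v [6, 14, 10, 8]"
  show False
  proof (rule no_K33_subdivision[of ?P ?Q ?R ?S ?T ?U "?v 0" "?v 6" "?v 1" "?v 2" "?v 4" "?v 8"])
    fix xs assume "xs \<in> {?P, ?Q, ?R, ?S, ?T, ?U}"
    then show "distinct xs \<and> 2 \<le> length xs \<and> set xs \<subseteq> verts G \<and> path_edges xs \<subseteq> undirected_edges G"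
      by (elim insertE; simp add: V E E' g_eq)
  qed (simp_all add: g_eq doubleton_eq_iff)
qed

section \<open>A straight-line drawing of the cube of dimension three\<close>

lemma planar_straight_line:
  fixes pos :: "'a \<Rightarrow> complex" and G :: "('a, 'b) pre_digraph"
  assumes inj: "inj_on pos (verts G)"
    and ends: "\<And>a. a \<in> arcs G \<Longrightarrow> tail G a \<in> verts G \<and> head G a \<in> verts G \<and> tail G a \<noteq> head G a"
    and vertex: "\<And>a w. a \<in> arcs G \<Longrightarrow> w \<in> verts G \<Longrightarrow>
      pos w \<in> closed_segment (pos (tail G a)) (pos (head G a)) \<Longrightarrow> w \<in> {tail G a, head G a}"
    and cross: "\<And>a b p. a \<in> arcs G \<Longrightarrow> b \<in> arcs G \<Longrightarrow> {tail G a, head G a} \<noteq> {tail G b, head G b} \<Longrightarrow>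
      p \<in> closed_segment (pos (tail G a)) (pos (head G a)) \<Longrightarrow>
      p \<in> closed_segment (pos (tail G b)) (pos (head G b)) \<Longrightarrow>
      p \<in> pos ` ({tail G a, head G a} \<inter> {tail G b, head G b})"
  shows "planar G"
proof -
  \<comment> \<open>An unordered edge has no distinguished start; some arc over \<open>e\<close> is
    chosen to orient its segment.\<close>
  define arc_of where "arc_of e = (SOME a. a \<in> arcs G \<and> e = {tail G a, head G a})" for e
  define curve where "curve e = linepath (pos (tail G (arc_of e))) (pos (head G (arc_of e)))" for e
  have arc_of: "arc_of e \<in> arcs G \<and> e = {tail G (arc_of e), head G (arc_of e)}"
    if "e \<in> undirected_edges G" for e
    unfolding arc_of_def by (rule someI_ex) (use that in \<open>auto simp: undirected_edges_def\<close>)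
  have "plane_drawing G pos curve"
    unfolding plane_drawing_def
  proof (intro conjI ballI impI inj)
    fix e assume e: "e \<in> undirected_edges G"
    define u v where uv: "u = tail G (arc_of e)" "v = head G (arc_of e)"
    have a: "arc_of e \<in> arcs G" and e_uv: "e = {u, v}" using arc_of[OF e] by (simp_all only: uv)
    have c: "curve e = linepath (pos u) (pos v)" by (simp only: curve_def uv)
    have uvG: "u \<in> verts G" "v \<in> verts G" "u \<noteq> v" using ends[OF a] by (simp_all add: uv)
    then have "pos u \<noteq> pos v" using inj by (simp add: inj_on_eq_iff)
    then show "simple_path (curve e)" unfolding c by (simp add: arc_imp_simple_path)
    show "{pathstart (curve e), pathfinish (curve e)} = pos ` e" unfolding c unfolding e_uv by simp
    have "pos u \<in> path_image (curve e)" "pos v \<in> path_image (curve e)" unfolding c by simp_all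
    moreover have "w \<in> {u, v}" if "w \<in> verts G" "pos w \<in> path_image (curve e)" for w
      using vertex[OF a that(1)] that(2) unfolding c uv[symmetric] by simp
    ultimately have "path_image (curve e) \<inter> pos ` verts G = pos ` {u, v}"
      using uvG by auto
    then show "path_image (curve e) \<inter> pos ` verts G = pos ` e" by (simp only: e_uv)
    fix f assume f: "f \<in> undirected_edges G" and "e \<noteq> f"
    show "path_image (curve e) \<inter> path_image (curve f) \<subseteq> pos ` (e \<inter> f)"
    proof
      fix p assume "p \<in> path_image (curve e) \<inter> path_image (curve f)"
      then show "p \<in> pos ` (e \<inter> f)"
        using cross[of "arc_of e" "arc_of f" p] arc_of[OF f] \<open>e \<noteq> f\<close> a
        unfolding curve_def path_image_linepath conjunct2[OF arc_of[OF e], symmetric]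
          conjunct2[OF arc_of[OF f], symmetric] by blast
    qed
  qed
  then show ?thesis unfolding planar_def by blast
qed

definition cube_graph :: "(bool \<times> bool \<times> bool, (bool \<times> bool \<times> bool) \<times> (bool \<times> bool \<times> bool)) pre_digraph" where
  "cube_graph = \<lparr>verts = UNIV,
     arcs = {((False, y, z), (True, y, z)) | y z. True} \<union> {((x, False, z), (x, True, z)) | x z. True} \<union>
       {((x, y, False), (x, y, True)) | x y. True},
     tail = fst, head = snd\<rparr>"

definition cube_sign :: "bool \<Rightarrow> real" where "cube_sign b = (if b then 1 else -1)"

definition cube_scale :: "bool \<Rightarrow> real" where "cube_scale b = (if b then 3 else 1)"

text \<open>Two concentric squares joined along the diagonals.\<close>

definition cube_pos :: "bool \<times> bool \<times> bool \<Rightarrow> complex" where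
  "cube_pos = (\<lambda>(x, y, z). Complex (cube_scale z * cube_sign x) (cube_scale z * cube_sign y))"

lemma closed_segment_coordinates:
  assumes "p \<in> closed_segment (Complex a b) (Complex c d)"
  obtains u where "0 \<le> u" "u \<le> 1" "Re p = a + u * (c - a)" "Im p = b + u * (d - b)"
proof -
  obtain u where u: "0 \<le> u" "u \<le> 1" "p = (1 - u) *\<^sub>R Complex a b + u *\<^sub>R Complex c d"
    using assms unfolding closed_segment_def by blast
  have "Re p = a + u * (c - a)" "Im p = b + u * (d - b)"
    unfolding u(3) by (simp_all add: algebra_simps)
  then show thesis using that u(1,2) by blast
qed

text \<open>The edges are horizontal sides, vertical sides and diagonal spokes. These conditions on
  coordinates reduce planarity to a finite case distinction over signs and scales.\<close>

lemma cube_segment: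
  shows "p \<in> closed_segment (cube_pos (False, y, z)) (cube_pos (True, y, z)) \<Longrightarrow>
      Im p = cube_scale z * cube_sign y \<and> \<bar>Re p\<bar> \<le> cube_scale z"
    and "p \<in> closed_segment (cube_pos (x, False, z)) (cube_pos (x, True, z)) \<Longrightarrow>
      Re p = cube_scale z * cube_sign x \<and> \<bar>Im p\<bar> \<le> cube_scale z"
    and "p \<in> closed_segment (cube_pos (x, y, False)) (cube_pos (x, y, True)) \<Longrightarrow>
      \<exists>t. 1 \<le> t \<and> t \<le> 3 \<and> Re p = t * cube_sign x \<and> Im p = t * cube_sign y"
proof -
  assume "p \<in> closed_segment (cube_pos (False, y, z)) (cube_pos (True, y, z))"
  then show "Im p = cube_scale z * cube_sign y \<and> \<bar>Re p\<bar> \<le> cube_scale z"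
    unfolding cube_pos_def prod.case
    by (rule closed_segment_coordinates) (auto simp: cube_scale_def cube_sign_def)
next
  assume "p \<in> closed_segment (cube_pos (x, False, z)) (cube_pos (x, True, z))"
  then show "Re p = cube_scale z * cube_sign x \<and> \<bar>Im p\<bar> \<le> cube_scale z"
    unfolding cube_pos_def prod.case
    by (rule closed_segment_coordinates) (auto simp: cube_scale_def cube_sign_def)
next
  assume "p \<in> closed_segment (cube_pos (x, y, False)) (cube_pos (x, y, True))"
  then obtain u where "0 \<le> u" "u \<le> 1" "Re p = cube_sign x + u * (3 * cube_sign x - cube_sign x)"
      "Im p = cube_sign y + u * (3 * cube_sign y - cube_sign y)"
    unfolding cube_pos_def prod.case by (rule closed_segment_coordinates) (simp add: cube_scale_def)
  \<comment> \<open>The witness is \<open>1 + 2 * u\<close> because the scale runs from 1 at the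
    inner square to 3 at the outer one.\<close>
  then show "\<exists>t. 1 \<le> t \<and> t \<le> 3 \<and> Re p = t * cube_sign x \<and> Im p = t * cube_sign y"
    by (intro exI[of _ "1 + 2 * u"]) (simp add: algebra_simps)
qed

lemma cube_arc_cases:
  assumes "a \<in> arcs cube_graph"
  obtains y z where "a = ((False, y, z), (True, y, z))"
  | x z where "a = ((x, False, z), (x, True, z))"
  | x y where "a = ((x, y, False), (x, y, True))"
  using assms unfolding cube_graph_def by auto

lemma cube_pos_eq_iff: "p = cube_pos (x, y, z) \<longleftrightarrow> Re p = cube_scale z * cube_sign x \<and> Im p = cube_scale z * cube_sign y"
  by (simp add: cube_pos_def complex_eq_iff)

lemma planar_cube_graph: "planar cube_graph"
proof (rule planar_straight_line[of cube_pos])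
  have [simp]: "tail cube_graph a = fst a" "head cube_graph a = snd a" "verts cube_graph = UNIV" for a
    by (simp_all add: cube_graph_def)
  note defs = cube_scale_def cube_sign_def
  show inj: "inj_on cube_pos (verts cube_graph)"
    by (auto simp: inj_on_def cube_pos_def defs split: if_splits)
  show "tail cube_graph a \<in> verts cube_graph \<and> head cube_graph a \<in> verts cube_graph \<and>
      tail cube_graph a \<noteq> head cube_graph a" if "a \<in> arcs cube_graph" for a
    using that by (rule cube_arc_cases) simp_all
  show "w \<in> {tail cube_graph a, head cube_graph a}"
    if "a \<in> arcs cube_graph"
      and "cube_pos w \<in> closed_segment (cube_pos (tail cube_graph a)) (cube_pos (head cube_graph a))" for a w
  proof -
    obtain x y z where w: "w = (x, y, z)" by (cases w) auto
    have p: "Re (cube_pos w) = cube_scale z * cube_sign x" "Im (cube_pos w) = cube_scale z * cube_sign y"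
      by (simp_all add: w cube_pos_def)
    show ?thesis
      using that(1)
    proof (cases rule: cube_arc_cases)
      case (1 y' z')
      then show ?thesis using cube_segment(1)[of "cube_pos w" y' z'] that(2) unfolding p
        by (cases x; cases y; cases z; cases y'; cases z') (simp_all add: w defs)
    next
      case (2 x' z')
      then show ?thesis using cube_segment(2)[of "cube_pos w" x' z'] that(2) unfolding p
        by (cases x; cases y; cases z; cases x'; cases z') (simp_all add: w defs)
    next
      case (3 x' y')
      then show ?thesis using cube_segment(3)[of "cube_pos w" x' y'] that(2) unfolding p
        by (cases x; cases y; cases z; cases x'; cases y') (auto simp: w defs)
    qed
  qed
  \<comment> \<open>Edges of the same direction meet only if they coincide; edges of different
    directions meet only in a common end, which \<open>XY\<close>, \<open>XZ\<close> and
    \<open>YZ\<close> name.\<close>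
  have XX: "y = y' \<and> z = z'"
    if "p \<in> closed_segment (cube_pos (False, y, z)) (cube_pos (True, y, z))"
      "p \<in> closed_segment (cube_pos (False, y', z')) (cube_pos (True, y', z'))" for p y z y' z'
    using cube_segment(1)[OF that(1)] cube_segment(1)[OF that(2)]
    by (cases y; cases z; cases y'; cases z') (simp_all add: defs)
  have YY: "x = x' \<and> z = z'"
    if "p \<in> closed_segment (cube_pos (x, False, z)) (cube_pos (x, True, z))"
      "p \<in> closed_segment (cube_pos (x', False, z')) (cube_pos (x', True, z'))" for p x z x' z'
    using cube_segment(2)[OF that(1)] cube_segment(2)[OF that(2)]
    by (cases x; cases z; cases x'; cases z') (simp_all add: defs)
  have ZZ: "x = x' \<and> y = y'"
    if "p \<in> closed_segment (cube_pos (x, y, False)) (cube_pos (x, y, True))"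
      "p \<in> closed_segment (cube_pos (x', y', False)) (cube_pos (x', y', True))" for p x y x' y'
    using cube_segment(3)[OF that(1)] cube_segment(3)[OF that(2)]
    by (cases x; cases y; cases x'; cases y') (auto simp: defs)
  have XY: "z = z' \<and> p = cube_pos (x', y, z)"
    if "p \<in> closed_segment (cube_pos (False, y, z)) (cube_pos (True, y, z))"
      "p \<in> closed_segment (cube_pos (x', False, z')) (cube_pos (x', True, z'))" for p y z x' z'
    using cube_segment(1)[OF that(1)] cube_segment(2)[OF that(2)] unfolding cube_pos_eq_iff
    by (cases y; cases z; cases x'; cases z') (simp_all add: defs)
  have XZ: "y = y' \<and> p = cube_pos (x', y, z)"
    if "p \<in> closed_segment (cube_pos (False, y, z)) (cube_pos (True, y, z))"
      "p \<in> closed_segment (cube_pos (x', y', False)) (cube_pos (x', y', True))" for p y z x' y'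
    using cube_segment(1)[OF that(1)] cube_segment(3)[OF that(2)] unfolding cube_pos_eq_iff
    by (cases y; cases z; cases x'; cases y') (auto simp: defs)
  have YZ: "x = x' \<and> p = cube_pos (x, y', z)"
    if "p \<in> closed_segment (cube_pos (x, False, z)) (cube_pos (x, True, z))"
      "p \<in> closed_segment (cube_pos (x', y', False)) (cube_pos (x', y', True))" for p x z x' y'
    using cube_segment(2)[OF that(1)] cube_segment(3)[OF that(2)] unfolding cube_pos_eq_iff
    by (cases x; cases z; cases x'; cases y') (auto simp: defs)
  have meet: "\<exists>v \<in> {fst a, snd a} \<inter> {fst b, snd b}. p = cube_pos v"
    if a: "a \<in> arcs cube_graph" and b: "b \<in> arcs cube_graph" and ne: "{fst a, snd a} \<noteq> {fst b, snd b}"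
      and p: "p \<in> closed_segment (cube_pos (fst a)) (cube_pos (snd a))"
        "p \<in> closed_segment (cube_pos (fst b)) (cube_pos (snd b))" for a b p
    using a
  proof (cases rule: cube_arc_cases)
    case a: (1 y z)
    from b show ?thesis
    proof (cases rule: cube_arc_cases)
      case (1 y' z')
      then show ?thesis using XX[of p y z y' z'] p ne a by simp
    next
      case (2 x' z')
      then show ?thesis using XY[of p y z x' z'] p a
        by (intro bexI[of _ "(x', y, z)"]) simp_all
    next
      case (3 x' y')
      then show ?thesis using XZ[of p y z x' y'] p a
        by (intro bexI[of _ "(x', y, z)"]) simp_all
    qed
  next
    case a: (2 x z)
    from b show ?thesis
    proof (cases rule: cube_arc_cases)
      case (1 y' z')
      then show ?thesis using XY[of p y' z' x z] p a
        by (intro bexI[of _ "(x, y', z)"]) simp_all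
    next
      case (2 x' z')
      then show ?thesis using YY[of p x z x' z'] p ne a by simp
    next
      case (3 x' y')
      then show ?thesis using YZ[of p x z x' y'] p a
        by (intro bexI[of _ "(x, y', z)"]) simp_all
    qed
  next
    case a: (3 x y)
    from b show ?thesis
    proof (cases rule: cube_arc_cases)
      case (1 y' z')
      then show ?thesis using XZ[of p y' z' x y] p a
        by (intro bexI[of _ "(x, y, z')"]) simp_all
    next
      case (2 x' z')
      then show ?thesis using YZ[of p x' z' x y] p a
        by (intro bexI[of _ "(x, y, z')"]) simp_all
    next
      case (3 x' y')
      then show ?thesis using ZZ[of p x y x' y'] p ne a by simp
    qed
  qed
  show "p \<in> cube_pos ` ({tail cube_graph a, head cube_graph a} \<inter> {tail cube_graph b, head cube_graph b})"
    if "a \<in> arcs cube_graph" "b \<in> arcs cube_graph"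
      and "{tail cube_graph a, head cube_graph a} \<noteq> {tail cube_graph b, head cube_graph b}"
      and "p \<in> closed_segment (cube_pos (tail cube_graph a)) (cube_pos (head cube_graph a))"
        "p \<in> closed_segment (cube_pos (tail cube_graph b)) (cube_pos (head cube_graph b))" for a b p
    using meet[OF that(1,2), of p] that(3-) by auto
qed

section \<open>Lower intervals of distinct words\<close>

text \<open>The subsets of four chosen letters index a cube of dimension four: their products lie
  below the whole word by the subword property, and deleting a letter gives an edge.\<close>

lemma distinct_word_not_planar:
  assumes xs: "distinct xs" "reduced_word n xs" and len: "length xs \<ge> 4"
  shows "\<not> planar (lower_bruhat_graph n (adj_word_prod xs))"
proof -
  let ?\<sigma> = "adj_word_prod xs"
  have sub: "set xs \<subseteq> {1..<n}" using xs(2) by (simp add: reduced_word_def)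
  have \<sigma>: "?\<sigma> permutes {1..n}" by (rule adj_word_prod_permutes[OF sub])
  have "4 \<le> card (set xs)" using len xs(1) by (simp add: distinct_card)
  then obtain B where B: "B \<subseteq> set xs" "card B = 4" "finite B"
    by (meson obtain_subset_with_card_n)
  then obtain ys where ys: "set ys = B" "distinct ys" by (metis finite_distinct_list)
  then have "length ys = Suc (Suc (Suc (Suc 0)))" using B(2) by (simp add: distinct_card[symmetric])
  then obtain a b c d where "ys = [a, b, c, d]" unfolding length_Suc_conv length_0_conv by blast
  then have abcd: "B = {a, b, c, d}" "distinct [a, b, c, d]" using ys by simp_all
  define S where "S p q r s = {x. x = a \<and> p \<or> x = b \<and> q \<or> x = c \<and> r \<or> x = d \<and> s}" for p q r s
  have S: "S p q r s \<subseteq> set xs" for p q r s using B(1) abcd(1) by (auto simp: S_def)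
  have S_eq: "S p q r s = S p' q' r' s' \<longleftrightarrow> p = p' \<and> q = q' \<and> r = r' \<and> s = s'" for p q r s p' q' r' s'
    using abcd(2) unfolding S_def set_eq_iff by auto
  have le: "bruhat_le n (subword_prod xs A) ?\<sigma>" for A
    unfolding subword_prod_def by (intro bruhat_le_subword xs(2)) simp
  have edge: "{subword_prod xs A, subword_prod xs (A - {x})} \<in> undirected_edges (lower_bruhat_graph n ?\<sigma>)"
    if "x \<in> A" "x \<in> set xs" for x A
    using subword_prod_delete_transpose[OF xs(1) sub that] transpose_edge[OF \<sigma> le le] by blast
  have abcd_mem: "a \<in> set xs" "b \<in> set xs" "c \<in> set xs" "d \<in> set xs" using B(1) abcd(1) by auto
  have del: "S False q r s = S True q r s - {a}" "S p False r s = S p True r s - {b}"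
      "S p q False s = S p q True s - {c}" "S p q r False = S p q r True - {d}" for p q r s
    using abcd(2) by (auto simp: S_def)
  show ?thesis
  proof (rule Q4_not_planar[of "\<lambda>p q r s. subword_prod xs (S p q r s)"])
    show "subword_prod xs (S p q r s) \<in> verts (lower_bruhat_graph n ?\<sigma>)" for p q r s
      using le by (simp add: verts_lower_bruhat_graph[OF \<sigma>])
    show "subword_prod xs (S p q r s) = subword_prod xs (S p' q' r' s') \<longleftrightarrow>
        p = p' \<and> q = q' \<and> r = r' \<and> s = s'" for p q r s p' q' r' s'
      using inj_on_subword_prod[OF xs(1)] S S_eq by (metis PowI inj_on_eq_iff)
  qed (unfold del; intro edge abcd_mem; simp add: S_def)+
qed

text \<open>Each vertex is the product of a unique set of letters, and a step downwards removes one
  letter. Recording which letters occur therefore embeds the graph in the cube.\<close>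

lemma distinct_word_planar:
  assumes xs: "distinct xs" "set xs \<subseteq> {1..<n}" and len: "length xs \<le> 3"
  shows "planar (lower_bruhat_graph n (adj_word_prod xs))"
proof -
  let ?\<sigma> = "adj_word_prod xs"
  have \<sigma>: "?\<sigma> permutes {1..n}" by (rule adj_word_prod_permutes[OF xs(2)])
  have "card (set xs) \<le> 3" using len xs(1) by (simp add: distinct_card)
  \<comment> \<open>\<open>{1..3}\<close> supplies spare elements, so that a set \<open>B\<close> of
    exactly three elements contains all letters even when the word is shorter.\<close>
  moreover have "3 \<le> card (set xs \<union> {1..3})" using card_mono[of "set xs \<union> {1..3}" "{1..3}"] by simp
  ultimately obtain B where B: "set xs \<subseteq> B" "card B = 3"
    using exists_subset_between[of "set xs" 3 "set xs \<union> {1..3}"] by auto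
  then obtain a b c where abc: "B = {a, b, c}" "a \<noteq> b" "a \<noteq> c" "b \<noteq> c" by (meson card_3_iff)
  define h where "h A = (a \<in> A, b \<in> A, c \<in> A)" for A
  define g where "g \<tau> = h (the_inv_into (Pow (set xs)) (subword_prod xs) \<tau>)" for \<tau>
  note inj = inj_on_subword_prod[OF xs(1)]
  have g: "g (subword_prod xs A) = h A" if "A \<subseteq> set xs" for A
    using that inj by (simp add: g_def the_inv_into_f_f)
  have below: "\<exists>A \<subseteq> set xs. \<tau> = subword_prod xs A" if "bruhat_le n \<tau> ?\<sigma>" for \<tau>
    by (rule bruhat_le_subword_prod[OF xs that])
  show ?thesis
  proof (rule planar_embedding[OF planar_cube_graph, of g])
    show "inj_on g (verts (lower_bruhat_graph n ?\<sigma>))"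
    proof (rule inj_onI)
      fix \<rho> \<tau> assume verts: "\<rho> \<in> verts (lower_bruhat_graph n ?\<sigma>)" "\<tau> \<in> verts (lower_bruhat_graph n ?\<sigma>)"
        and eq: "g \<rho> = g \<tau>"
      obtain A where A: "A \<subseteq> set xs" "\<rho> = subword_prod xs A"
        using below[of \<rho>] verts(1) by (auto simp: verts_lower_bruhat_graph[OF \<sigma>])
      obtain A' where A': "A' \<subseteq> set xs" "\<tau> = subword_prod xs A'"
        using below[of \<tau>] verts(2) by (auto simp: verts_lower_bruhat_graph[OF \<sigma>])
      have "h A = h A'" using eq g[OF A(1)] g[OF A'(1)] A(2) A'(2) by simp
      then have "x \<in> A \<longleftrightarrow> x \<in> A'" if "x \<in> B" for x using that abc(1) by (auto simp: h_def)
      then have "A = A'" using A(1) A'(1) B(1) by blast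
      then show "\<rho> = \<tau>" using A(2) A'(2) by simp
    qed
    show "g ` verts (lower_bruhat_graph n ?\<sigma>) \<subseteq> verts cube_graph" by (simp add: cube_graph_def)
    fix e assume "e \<in> undirected_edges (lower_bruhat_graph n ?\<sigma>)"
    then obtain \<rho> \<tau> where e: "e = {\<rho>, \<tau>}" "bruhat_step n \<rho> \<tau>" "bruhat_le n \<tau> ?\<sigma>"
      unfolding undirected_edges_lower_bruhat_graph[OF \<sigma>] by blast
    obtain A where A: "A \<subseteq> set xs" "\<tau> = subword_prod xs A" using below[OF e(3)] by (elim exE conjE)
    obtain d where d: "d \<in> A" "\<rho> = subword_prod xs (A - {d})"
      using bruhat_step_subword_prod[OF xs e(2)[unfolded A(2)]] by (elim bexE)
    have "bruhat_le n \<rho> ?\<sigma>"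
      using e(2,3) unfolding bruhat_le_def by (rule converse_rtranclp_into_rtranclp)
    then have "e \<subseteq> verts (lower_bruhat_graph n ?\<sigma>)"
      using e by (simp add: verts_lower_bruhat_graph[OF \<sigma>])
    moreover have "A - {d} \<subseteq> set xs" using A(1) by blast
    then have "g ` e = {h (A - {d}), h A}" using g[OF A(1)] g[of "A - {d}"] by (simp add: e(1) A(2) d(2))
    moreover have "d \<in> {a, b, c}" using d(1) A(1) B(1) abc(1) by blast
    then have "(h (A - {d}), h A) \<in> arcs cube_graph"
      using abc(2-) d(1) by (auto simp: h_def cube_graph_def)
    then have "{h (A - {d}), h A} \<in> undirected_edges cube_graph"
      unfolding undirected_edges_def by (rule rev_image_eqI) (simp add: cube_graph_def)
    ultimately show "e \<subseteq> verts (lower_bruhat_graph n ?\<sigma>) \<and> g ` e \<in> undirected_edges cube_graph" by simp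
  qed
qed

text \<open>For distinct letters the length decides planarity, and a planar graph excludes 321 by
  \<open>has_321_not_planar\<close>. A repeated letter puts \<open>[d, e, d]\<close> below
  \<open>\<sigma>\<close>, so both sides are false.\<close>

lemma planar_lower_bruhat_graph_iff:
  assumes \<sigma>: "\<sigma> permutes {1..n}"
  shows "planar (lower_bruhat_graph n \<sigma>) \<longleftrightarrow> \<not> has_321 n \<sigma> \<and> card (inversions n \<sigma>) \<le> 3"
proof -
  obtain xs where xs: "length xs = card (inversions n \<sigma>)" "set xs \<subseteq> {1..<n}" "\<sigma> = adj_word_prod xs"
    using ex_word_card_inversions[OF \<sigma>] by blast
  then have red: "reduced_word n xs" by (simp add: reduced_word_def)
  show ?thesis
  proof (cases "distinct xs")
    case True
    have "planar (lower_bruhat_graph n \<sigma>) \<longleftrightarrow> length xs \<le> 3"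
      using distinct_word_not_planar[OF True red] distinct_word_planar[OF True xs(2)]
      unfolding xs(3)[symmetric] by fastforce
    then show ?thesis using has_321_not_planar[OF \<sigma>] xs(1) by metis
  next
    case False
    then obtain d e where de: "e = Suc d \<or> d = Suc e" "subseq [d, e, d] xs"
      using reduced_word_repetition[OF red] by blast
    have "set [d, e, d] \<subseteq> set xs" using list_emb_set[OF de(2)] by (metis subsetI)
    then have braid: "has_321 n (adj_word_prod [d, e, d])" using xs(2) by (intro has_321_braid de(1)) auto
    have le: "bruhat_le n (adj_word_prod [d, e, d]) \<sigma>"
      unfolding xs(3) by (rule bruhat_le_subword[OF de(2) red])
    have "\<not> planar (lower_bruhat_graph n \<sigma>)"
      using has_321_not_planar[OF bruhat_le_permutes[OF le \<sigma>] braid] planar_lower_bruhat_graph_mono[OF _ \<sigma> le]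
      by blast
    \<comment> \<open>A word of at most three letters with \<open>[d, e, d]\<close> as a subword is
      that braid itself, so the right-hand side fails too.\<close>
    moreover have "has_321 n \<sigma>" if "length xs \<le> 3"
    proof -
      have "length [d, e, d] = length xs" using list_emb_length[OF de(2)] that by simp
      then have "[d, e, d] = xs" using de(2) subseq_same_length by blast
      then show ?thesis using braid xs(3) by simp
    qed
    ultimately show ?thesis using xs(1) by auto
  qed
qed

subsection \<open>Patterns\<close>

lemma perm_contains_321_iff:
  "perm_contains n \<sigma> 3 (one_line [3, 2, 1]) \<longleftrightarrow> has_321 n \<sigma>"
proof
  assume "perm_contains n \<sigma> 3 (one_line [3, 2, 1])"
  then obtain f where f: "strict_mono_on {1..3} f" "f ` {1..3} \<subseteq> {1..n}"
      "\<forall>a\<in>{1..3}. \<forall>b\<in>{1..3}. \<sigma> (f a) < \<sigma> (f b) \<longleftrightarrow> one_line [3, 2, 1] a < one_line [3, 2, 1] b"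
    unfolding perm_contains_def by blast
  have "f 1 < f 2" "f 2 < f 3" using f(1) by (auto simp: strict_mono_on_def)
  moreover have "f 1 \<in> {1..n}" "f 3 \<in> {1..n}" using f(2) by (simp_all add: image_subset_iff)
  moreover have "\<sigma> (f 3) < \<sigma> (f 2)" "\<sigma> (f 2) < \<sigma> (f 1)" using f(3) by (auto simp: one_line_def)
  ultimately show "has_321 n \<sigma>" unfolding has_321_def by (intro exI[of _ "f 1"] exI[of _ "f 2"] exI[of _ "f 3"]) simp
next
  assume "has_321 n \<sigma>"
  then obtain i j k where ijk: "1 \<le> i" "i < j" "j < k" "k \<le> n" "\<sigma> i > \<sigma> j" "\<sigma> j > \<sigma> k"
    unfolding has_321_def by blast
  have three: "a \<in> {1..3} \<longleftrightarrow> a = 1 \<or> a = 2 \<or> a = (3::nat)" for a by auto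
  show "perm_contains n \<sigma> 3 (one_line [3, 2, 1])"
    unfolding perm_contains_def
  \<comment> \<open>Here \<open>one_line\<close> serves as the embedding that lists the positions
    \<open>i\<close>, \<open>j\<close>, \<open>k\<close>.\<close>
  proof (intro exI[of _ "one_line [i, j, k]"] conjI)
    show "strict_mono_on {1..3} (one_line [i, j, k])"
      using ijk unfolding strict_mono_on_def three by (auto simp: one_line_def)
    show "one_line [i, j, k] ` {1..3} \<subseteq> {1..n}"
      using ijk unfolding image_subset_iff Ball_def three by (auto simp: one_line_def)
    show "\<forall>a\<in>{1..3}. \<forall>b\<in>{1..3}. \<sigma> (one_line [i, j, k] a) < \<sigma> (one_line [i, j, k] b) \<longleftrightarrow>
        one_line [3, 2, 1] a < one_line [3, 2, 1] b"
      using ijk unfolding Ball_def three by (auto simp: one_line_def)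
  qed
qed

section \<open>Inversions of patterns\<close>

text \<open>The embedding of positions carries inversions of the pattern injectively to inversions
  of \<open>\<sigma>\<close>.\<close>

lemma perm_contains_card_inversions_le:
  assumes "perm_contains n \<sigma> m \<pi>"
  shows "card (inversions m \<pi>) \<le> card (inversions n \<sigma>)"
proof -
  obtain f where f: "strict_mono_on {1..m} f" "f ` {1..m} \<subseteq> {1..n}"
      "\<forall>a\<in>{1..m}. \<forall>b\<in>{1..m}. \<sigma> (f a) < \<sigma> (f b) \<longleftrightarrow> \<pi> a < \<pi> b"
    using assms unfolding perm_contains_def by blast
  have sub: "inversions m \<pi> \<subseteq> {1..m} \<times> {1..m}" by (auto simp: inversions_def)
  have "inj_on (map_prod f f) ({1..m} \<times> {1..m})"
    using strict_mono_on_imp_inj_on[OF f(1)] by (intro map_prod_inj_on)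
  moreover have "map_prod f f ` inversions m \<pi> \<subseteq> inversions n \<sigma>"
  proof (intro image_subsetI)
    fix p assume p: "p \<in> inversions m \<pi>"
    obtain a b where ab: "p = (a, b)" by (cases p)
    have "a \<in> {1..m}" "b \<in> {1..m}" "a < b" "\<pi> b < \<pi> a" using p unfolding ab by (auto simp: inversions_def)
    moreover from this have "f a < f b" "\<sigma> (f b) < \<sigma> (f a)"
      using f(1,3) by (auto simp: strict_mono_on_def)
    moreover have "f a \<in> {1..n}" "f b \<in> {1..n}" using f(2) calculation(1,2) by blast+
    ultimately show "map_prod f f p \<in> inversions n \<sigma>" by (simp add: ab inversions_def)
  qed
  ultimately show ?thesis
    using sub by (intro card_inj_on_le[OF inj_on_subset[of "map_prod f f"]] finite_inversions) auto
qed

text \<open>Standardization: \<open>f\<close> lists the positions in \<open>I\<close> and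
  \<open>h'\<close> the values on \<open>I\<close>, both increasingly, and \<open>\<pi> a\<close> is
  the rank of \<open>\<sigma> (f a)\<close> among these values.\<close>

lemma ex_pattern_on:
  fixes \<sigma> :: "nat \<Rightarrow> nat"
  assumes \<sigma>: "\<sigma> permutes {1..n}" and I: "I \<subseteq> {1..n}"
  shows "\<exists>\<pi> f. \<pi> permutes {1..card I} \<and> strict_mono_on {1..card I} f \<and> f ` {1..card I} = I \<and>
    (\<forall>a\<in>{1..card I}. \<forall>b\<in>{1..card I}. \<sigma> (f a) < \<sigma> (f b) \<longleftrightarrow> \<pi> a < \<pi> b)"
proof -
  define m where "m = card I"
  have fin: "finite I" "finite (\<sigma> ` I)" using finite_subset[OF I finite_atLeastAtMost] by simp_all
  have card: "card (\<sigma> ` I) = m"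
    unfolding m_def using permutes_inj_on[OF \<sigma>] by (intro card_image)
  obtain g where g: "bij_betw g {..<m} I" "strict_mono_on {..<m} g"
    unfolding m_def by (rule ex_bij_betw_strict_mono_card[OF fin(1)])
  obtain h where h: "bij_betw h {..<m} (\<sigma> ` I)" "strict_mono_on {..<m} h"
    using ex_bij_betw_strict_mono_card[OF fin(2)] unfolding card .
  \<comment> \<open>The enumerations \<open>g\<close> and \<open>h\<close> start at 0, positions of
    a permutation at 1.\<close>
  have pred: "bij_betw (\<lambda>a. a - 1) {1..m} {..<m}"
    by (rule bij_betwI[of _ _ _ Suc]) auto
  have pred_mono: "strict_mono_on {1..m} (\<lambda>a. k (a - 1))" if "strict_mono_on {..<m} k" for k :: "nat \<Rightarrow> nat"
    by (intro strict_mono_onI strict_mono_onD[OF that]) auto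
  define f where "f a = g (a - 1)" for a
  define h' where "h' a = h (a - 1)" for a
  have f: "bij_betw f {1..m} I" "strict_mono_on {1..m} f"
    unfolding f_def using bij_betw_trans[OF pred g(1)] pred_mono[OF g(2)] by (simp_all add: comp_def)
  have h': "bij_betw h' {1..m} (\<sigma> ` I)" "strict_mono_on {1..m} h'"
    unfolding h'_def using bij_betw_trans[OF pred h(1)] pred_mono[OF h(2)] by (simp_all add: comp_def)
  define \<pi> where "\<pi> a = (if a \<in> {1..m} then inv_into {1..m} h' (\<sigma> (f a)) else a)" for a
  have "bij_betw \<sigma> I (\<sigma> ` I)" using permutes_inj_on[OF \<sigma>] by (simp add: bij_betw_def)
  then have "bij_betw (\<lambda>a. inv_into {1..m} h' (\<sigma> (f a))) {1..m} {1..m}"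
    using bij_betw_trans[OF bij_betw_trans[OF f(1)] bij_betw_inv_into[OF h'(1)]] by (simp add: comp_def)
  then have "bij_betw \<pi> {1..m} {1..m}"
    by (rule bij_betw_cong[THEN iffD1, rotated]) (simp add: \<pi>_def)
  then have "\<pi> permutes {1..m}" by (rule bij_imp_permutes) (simp only: \<pi>_def if_False)
  moreover have "\<sigma> (f a) < \<sigma> (f b) \<longleftrightarrow> \<pi> a < \<pi> b" if "a \<in> {1..m}" "b \<in> {1..m}" for a b
  proof -
    have \<pi>: "h' (\<pi> x) = \<sigma> (f x)" "\<pi> x \<in> {1..m}" if x: "x \<in> {1..m}" for x
    proof -
      have "\<sigma> (f x) \<in> h' ` {1..m}" using x f(1) h'(1) unfolding bij_betw_def by blast
      then have "h' (inv_into {1..m} h' (\<sigma> (f x))) = \<sigma> (f x)" "inv_into {1..m} h' (\<sigma> (f x)) \<in> {1..m}"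
        by (rule f_inv_into_f, rule inv_into_into)
      moreover have "\<pi> x = inv_into {1..m} h' (\<sigma> (f x))" using x by (simp only: \<pi>_def if_True)
      ultimately show "h' (\<pi> x) = \<sigma> (f x)" "\<pi> x \<in> {1..m}" by (simp_all only:)
    qed
    show ?thesis using strict_mono_on_less[OF h'(2) \<pi>(2)[OF that(1)] \<pi>(2)[OF that(2)]]
      unfolding \<pi>(1)[OF that(1)] \<pi>(1)[OF that(2)] .
  qed
  ultimately show ?thesis using f unfolding m_def bij_betw_def by blast
qed

text \<open>The bound 8 counts two positions for each of four inversions; the pattern on these
  positions keeps all four.\<close>

lemma ex_pattern_4_inversions:
  assumes \<sigma>: "\<sigma> permutes {1..n}" and card: "card (inversions n \<sigma>) \<ge> 4"
  shows "\<exists>m \<pi>. m \<le> 8 \<and> \<pi> permutes {1..m} \<and> card (inversions m \<pi>) \<ge> 4 \<and> perm_contains n \<sigma> m \<pi>"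
proof -
  obtain T where T: "T \<subseteq> inversions n \<sigma>" "card T = 4" "finite T"
    using obtain_subset_with_card_n[OF card] by metis
  define I where "I = fst ` T \<union> snd ` T"
  have "card I \<le> card (fst ` T) + card (snd ` T)" unfolding I_def by (rule card_Un_le)
  also have "\<dots> \<le> 4 + 4" using card_image_le[OF T(3), of fst] card_image_le[OF T(3), of snd] T(2) by linarith
  finally have le: "card I \<le> 8" by simp
  have I: "I \<subseteq> {1..n}" using T(1) by (auto simp: I_def inversions_def)
  obtain \<pi> f where \<pi>: "\<pi> permutes {1..card I}" and f: "strict_mono_on {1..card I} f" "f ` {1..card I} = I"
      and iso: "\<forall>a\<in>{1..card I}. \<forall>b\<in>{1..card I}. \<sigma> (f a) < \<sigma> (f b) \<longleftrightarrow> \<pi> a < \<pi> b"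
    using ex_pattern_on[OF \<sigma> I] by blast
  have "T \<subseteq> map_prod f f ` inversions (card I) \<pi>"
  proof
    fix p assume p: "p \<in> T"
    obtain x y where xy: "p = (x, y)" by (cases p)
    have "x \<in> I" "y \<in> I" using p unfolding I_def xy by force+
    then obtain a b where ab: "a \<in> {1..card I}" "b \<in> {1..card I}" "x = f a" "y = f b"
      using f(2) by blast
    have "x < y" "\<sigma> y < \<sigma> x" using p T(1) unfolding xy by (auto simp: inversions_def)
    then have "a < b" "\<pi> b < \<pi> a"
      using ab iso strict_mono_on_less[OF f(1)] by auto
    then have "(a, b) \<in> inversions (card I) \<pi>" using ab by (simp add: inversions_def)
    then show "p \<in> map_prod f f ` inversions (card I) \<pi>" using ab by (auto simp: xy intro: rev_image_eqI)
  qed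
  then have "card T \<le> card (inversions (card I) \<pi>)"
    by (rule surj_card_le[OF finite_inversions])
  then have "card (inversions (card I) \<pi>) \<ge> 4" using T(2) by simp
  moreover have "perm_contains n \<sigma> (card I) \<pi>"
    unfolding perm_contains_def using f iso I by blast
  ultimately show ?thesis using le \<pi> by blast
qed

theorem corollary3p4:
  fixes n :: nat and \<sigma> :: "nat \<Rightarrow> nat"
  assumes "n \<ge> 1" and "\<sigma> permutes {1..n}"
  shows "planar (lower_bruhat_graph n \<sigma>) \<longleftrightarrow>
     perm_avoids n \<sigma> 3 (one_line [3, 2, 1]) \<and>
     (\<forall>m \<pi>. m \<le> 8 \<and> \<pi> permutes {1..m} \<and> perm_length m \<pi> \<ge> 4 \<longrightarrow> perm_avoids n \<sigma> m \<pi>)"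
proof -
  \<comment> \<open>The length bound is itself a pattern condition: a pattern never has more
    inversions than \<open>\<sigma>\<close>, and four inversions already show in a small
    pattern.\<close>
  have "card (inversions n \<sigma>) \<ge> 4 \<longleftrightarrow>
      (\<exists>m \<pi>. m \<le> 8 \<and> \<pi> permutes {1..m} \<and> perm_length m \<pi> \<ge> 4 \<and> perm_contains n \<sigma> m \<pi>)"
  proof
    assume four: "card (inversions n \<sigma>) \<ge> 4"
    obtain m \<pi> where "m \<le> 8" "\<pi> permutes {1..m}" "card (inversions m \<pi>) \<ge> 4"
        "perm_contains n \<sigma> m \<pi>"
      using ex_pattern_4_inversions[OF assms(2) four] by (elim exE conjE)
    then show "\<exists>m \<pi>. m \<le> 8 \<and> \<pi> permutes {1..m} \<and> perm_length m \<pi> \<ge> 4 \<and> perm_contains n \<sigma> m \<pi>"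
      by (intro exI[of _ m] exI[of _ \<pi>]) (simp add: perm_length_eq_card_inversions)
  next
    assume "\<exists>m \<pi>. m \<le> 8 \<and> \<pi> permutes {1..m} \<and> perm_length m \<pi> \<ge> 4 \<and> perm_contains n \<sigma> m \<pi>"
    then obtain m \<pi> where \<pi>: "\<pi> permutes {1..m}" "perm_length m \<pi> \<ge> 4" "perm_contains n \<sigma> m \<pi>"
      by (elim exE conjE)
    then have "4 \<le> card (inversions m \<pi>)" by (simp add: perm_length_eq_card_inversions)
    also have "\<dots> \<le> card (inversions n \<sigma>)" by (rule perm_contains_card_inversions_le[OF \<pi>(3)])
    finally show "card (inversions n \<sigma>) \<ge> 4" .
  qed
  moreover have "card (inversions n \<sigma>) \<le> 3 \<longleftrightarrow> \<not> card (inversions n \<sigma>) \<ge> 4" by linarith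
  ultimately have len: "card (inversions n \<sigma>) \<le> 3 \<longleftrightarrow>
      (\<forall>m \<pi>. m \<le> 8 \<and> \<pi> permutes {1..m} \<and> perm_length m \<pi> \<ge> 4 \<longrightarrow> perm_avoids n \<sigma> m \<pi>)"
    by blast
  show ?thesis
    unfolding planar_lower_bruhat_graph_iff[OF assms(2)] perm_contains_321_iff len by (rule refl)
qed

end
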